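(* Let $A$ be a smooth real vector bundle over a smooth manifold $M$. Then there is a one-to-one correspondence between elements $\varphi\in\mathrm{Der}^1(A)$ satisfying $[\varphi,\varphi]=0$ and Filippov algebroid structures (of order $n$) on $A$.
   Context: Let $n\ge2$ be fixed, $M$ a smooth manifold, $\chi(M)$ the space of vector fields, $A\to M$ a smooth real vector bundle, $\Gamma A$ its space of smooth sections. A Filippov algebra of order $n$ is a real vector space $L$ with an $\mathbb R$-multilinear skew-symmetric bracket $[~,\dots,~]:L^{n}\to L$ satisfying the fundamental identity $[a_1,\dots,a_{n-1},[b_1,\dots,b_n]]=\sum_{i=1}^n[b_1,\dots,b_{i-1},[a_1,\dots,a_{n-1},b_i],b_{i+1},\dots,b_n]$. A Filippov algebroid structure of order $n$ on $A$ is a Filippov algebra structure of order $n$ on the space $\Gamma A$ together with a bundle map $a:\wedge^{n-1}A\to TM$ (the anchor) such that (a) $[a(x_1\wedge\cdots\wedge x_{n-1}),a(y_1\wedge\cdots\wedge y_{n-1})]=\sum_{i=1}^{n-1}a(y_1\wedge\cdots\wedge[x_1,\dots,x_{n-1},y_i]\wedge y_{i+1}\wedge\cdots\wedge y_{n-1})$ (Lie bracket of vector fields on the left), and (b) $[x_1,\dots,x_{n-1},fy]=f[x_1,\dots,x_{n-1},y]+a(x_1\wedge\cdots\wedge x_{n-1})(f)y$, for all $x_i,y_i,y\in\Gamma A$, $f\in C^\infty(M)$. Put $\mathcal L(A):=\Gamma A\wedge\cdots\wedge\Gamma A$ ($n-1$ copies); elements are written $X=X^1\wedge\cdots\wedge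 X^{n-1}$ (formulas extended linearly). $\mathrm{Der}^1(A)$ (Filippov multiderivations of degree 1) is the set of $\mathbb R$-linear maps $D:\mathcal L(A)\wedge\Gamma A\to\Gamma A$, written $D(X,z)$ (so alternating in $X^1,\dots,X^{n-1},z$), for which there is a $C^\infty(M)$-multilinear map $\sigma_D:\mathcal L(A)\to\chi(M)$ (the symbol) with $D(X,fz)=fD(X,z)+\sigma_D(X)(f)z$ for all $X\in\mathcal L(A)$, $f\in C^\infty(M)$, $z\in\Gamma A$. For $D_1,D_2\in\mathrm{Der}^1(A)$ define $$(D_1\circ D_2)(X_1,X_2,z)=\sum_{s=1}^{n-1}D_1\big(X_2^1\wedge\cdots\wedge X_2^{s-1}\wedge D_2(X_1,X_2^s)\wedge X_2^{s+1}\wedge\cdots\wedge X_2^{n-1},z\big)-D_1(X_1,D_2(X_2,z))+D_1(X_2,D_2(X_1,z))$$ and $[D_1,D_2]:=-D_1\circ D_2-D_2\circ D_1$. *)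

theory Defs
  imports "HOL-Analysis.Analysis" "HOL-Library.Function_Algebras"
begin

text \<open>
  Sections, vector fields and tangent vectors are functions into real vector spaces. With the
  pointwise structure below, spaces of them are subspaces of a real vector space in the sense of
  the library.
\<close>

instantiation "fun" :: (type, real_vector) real_vector
begin

definition scaleR_fun :: "real \<Rightarrow> ('a \<Rightarrow> 'b) \<Rightarrow> 'a \<Rightarrow> 'b" where
  "scaleR_fun c f = (\<lambda>x. c *\<^sub>R f x)"

instance
  by standard (simp_all add: scaleR_fun_def fun_eq_iff scaleR_add_right scaleR_add_left)

end

lemma scaleR_fun_apply [simp]: "(c *\<^sub>R f) x = c *\<^sub>R f x"
  by (simp add: scaleR_fun_def)


section \<open>Smooth maps between Euclidean spaces\<close>

text \<open>\<open>Ck_on k W f\<close> is meant for open \<open>W\<close>: \<open>f\<close> is of class \<open>C\<^sup>k\<close> on \<open>W\<close>.\<close>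

primrec Ck_on :: "nat \<Rightarrow> 'a::euclidean_space set \<Rightarrow> ('a \<Rightarrow> 'b::real_normed_vector) \<Rightarrow> bool" where
  "Ck_on 0 W f \<longleftrightarrow> continuous_on W f"
| "Ck_on (Suc k) W f \<longleftrightarrow>
     (\<forall>x\<in>W. f differentiable (at x)) \<and> (\<forall>v. Ck_on k W (\<lambda>x. frechet_derivative f (at x) v))"

text \<open>
  Smoothness on an arbitrary subset of a Euclidean space, by local smooth extensions. For a
  relatively open subset of a linear subspace \<open>E\<close> this is ordinary smoothness on an open
  subset of the vector space \<open>E\<close>.
\<close>

definition smooth_on :: "'a::euclidean_space set \<Rightarrow> ('a \<Rightarrow> 'b::real_normed_vector) \<Rightarrow> bool" where
  "smooth_on S f \<longleftrightarrow>
     (\<forall>x\<in>S. \<exists>W g. open W \<and> x \<in> W \<and> (\<forall>k. Ck_on k W g) \<and> (\<forall>y\<in>W \<inter> S. g y = f y))"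


section \<open>Smooth manifolds\<close>

text \<open>
  The manifold is the whole type \<open>'m\<close>, Hausdorff and second countable by its type class, with a
  smooth atlas of charts \<open>(U, \<phi>)\<close>. The model space is a linear subspace \<open>E\<close> of a Euclidean space,
  so the manifold has dimension \<open>dim E\<close>; a subspace is used instead of a full type because
  types of class \<open>euclidean_space\<close> have positive dimension, while dimension \<open>0\<close> is allowed here.
\<close>

type_synonym ('m, 'e) atlas = "('m set \<times> ('m \<Rightarrow> 'e)) set"

definition smooth_manifold ::
  "'e::euclidean_space set \<Rightarrow> ('m::{t2_space, second_countable_topology}, 'e) atlas \<Rightarrow> bool" where
  "smooth_manifold E At \<longleftrightarrow>
     subspace E \<and>
     (\<Union>(U, \<phi>)\<in>At. U) = UNIV \<and>
     (\<forall>(U, \<phi>)\<in>At. open U \<and> openin (top_of_set E) (\<phi> ` U) \<and>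
        (\<exists>\<psi>. homeomorphism U (\<phi> ` U) \<phi> \<psi>)) \<and>
     (\<forall>(U, \<phi>)\<in>At. \<forall>(V, \<psi>)\<in>At. smooth_on (\<phi> ` (U \<inter> V)) (\<psi> \<circ> inv_into U \<phi>))"

definition smooth_map_on ::
  "('m::topological_space, 'e::euclidean_space) atlas \<Rightarrow> 'm set \<Rightarrow> ('m \<Rightarrow> 'b::real_normed_vector) \<Rightarrow> bool" where
  "smooth_map_on At W f \<longleftrightarrow> (\<forall>(U, \<phi>)\<in>At. smooth_on (\<phi> ` (U \<inter> W)) (f \<circ> inv_into U \<phi>))"

definition smooth_functions ::
  "('m::topological_space, 'e::euclidean_space) atlas \<Rightarrow> ('m \<Rightarrow> real) set" where
  "smooth_functions At = {f. smooth_map_on At UNIV f}"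

text \<open>
  \<open>T\<^sub>pM\<close> is the space of derivations at \<open>p\<close> of the algebra of smooth functions. Derivations are
  extended by \<open>0\<close> to non-smooth functions, so that they are determined by their values on smooth
  functions.
\<close>

definition tangent_space ::
  "('m::topological_space, 'e::euclidean_space) atlas \<Rightarrow> 'm \<Rightarrow> (('m \<Rightarrow> real) \<Rightarrow> real) set" where
  "tangent_space At p =
     {v. (\<forall>f\<in>smooth_functions At. \<forall>g\<in>smooth_functions At.
            v (f + g) = v f + v g \<and> v (f * g) = f p * v g + g p * v f) \<and>
         (\<forall>c. \<forall>f\<in>smooth_functions At. v (c *\<^sub>R f) = c * v f) \<and>
         (\<forall>f. f \<notin> smooth_functions At \<longrightarrow> v f = 0)}"

definition vector_fields ::
  "('m::topological_space, 'e::euclidean_space) atlas \<Rightarrow> ('m \<Rightarrow> ('m \<Rightarrow> real) \<Rightarrow> real) set" where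
  "vector_fields At =
     {X. (\<forall>p. X p \<in> tangent_space At p) \<and>
         (\<forall>f\<in>smooth_functions At. (\<lambda>p. X p f) \<in> smooth_functions At)}"

definition lie_bracket ::
  "('m \<Rightarrow> ('m \<Rightarrow> real) \<Rightarrow> real) \<Rightarrow> ('m \<Rightarrow> ('m \<Rightarrow> real) \<Rightarrow> real) \<Rightarrow> 'm \<Rightarrow> ('m \<Rightarrow> real) \<Rightarrow> real" where
  "lie_bracket X Y = (\<lambda>p f. X p (\<lambda>q. Y q f) - Y p (\<lambda>q. X q f))"


section \<open>Smooth vector bundles\<close>

text \<open>
  The fibres \<open>A p\<close> are linear subspaces of one ambient real vector space, without topology and
  of arbitrary dimension; every family of vector spaces is of this form up to isomorphism (embed
  it into its direct sum). The total space is \<open>{(p, v). v \<in> A p}\<close>. A local trivialization \<open>(U, \<tau>)\<close>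
  maps \<open>(p, v)\<close> with \<open>p \<in> U\<close> to \<open>(p, \<tau> p v)\<close>, \<open>\<tau> p\<close> being a linear isomorphism from \<open>A p\<close> onto the
  model fibre \<open>F\<close> (of dimension \<open>dim F\<close>, possibly \<open>0\<close>), with smooth transition functions.
\<close>

type_synonym ('m, 'v, 'f) trivializations = "('m set \<times> ('m \<Rightarrow> 'v \<Rightarrow> 'f)) set"

definition smooth_vector_bundle ::
  "('m::{t2_space, second_countable_topology}, 'e::euclidean_space) atlas \<Rightarrow> 'f::euclidean_space set \<Rightarrow>
   ('m \<Rightarrow> 'v::real_vector set) \<Rightarrow> ('m, 'v, 'f) trivializations \<Rightarrow> bool" where
  "smooth_vector_bundle At F A Tr \<longleftrightarrow>
     subspace F \<and> (\<forall>p. subspace (A p)) \<and>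
     (\<Union>(U, \<tau>)\<in>Tr. U) = UNIV \<and>
     (\<forall>(U, \<tau>)\<in>Tr. open U \<and>
        (\<forall>p\<in>U. bij_betw (\<tau> p) (A p) F \<and>
           (\<forall>v\<in>A p. \<forall>w\<in>A p. \<tau> p (v + w) = \<tau> p v + \<tau> p w) \<and>
           (\<forall>c. \<forall>v\<in>A p. \<tau> p (c *\<^sub>R v) = c *\<^sub>R \<tau> p v))) \<and>
     (\<forall>(U, \<tau>)\<in>Tr. \<forall>(V, \<tau>')\<in>Tr. \<forall>w\<in>F.
        smooth_map_on At (U \<inter> V) (\<lambda>p. \<tau>' p (inv_into (A p) (\<tau> p) w)))"

definition smooth_section_on ::
  "('m::topological_space, 'e::euclidean_space) atlas \<Rightarrow> ('m \<Rightarrow> 'v::real_vector set) \<Rightarrow>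
   ('m, 'v, 'f::euclidean_space) trivializations \<Rightarrow> 'm set \<Rightarrow> ('m \<Rightarrow> 'v) \<Rightarrow> bool" where
  "smooth_section_on At A Tr W s \<longleftrightarrow>
     (\<forall>p\<in>W. s p \<in> A p) \<and> (\<forall>(U, \<tau>)\<in>Tr. smooth_map_on At (U \<inter> W) (\<lambda>p. \<tau> p (s p)))"

definition smooth_sections ::
  "('m::topological_space, 'e::euclidean_space) atlas \<Rightarrow> ('m \<Rightarrow> 'v::real_vector set) \<Rightarrow>
   ('m, 'v, 'f::euclidean_space) trivializations \<Rightarrow> ('m \<Rightarrow> 'v) set" where
  "smooth_sections At A Tr = {s. smooth_section_on At A Tr UNIV s}"

text \<open>The \<open>C\<^sup>\<infinity>(M)\<close>-module structure, both on sections and on vector fields.\<close>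

definition fscale :: "('m \<Rightarrow> real) \<Rightarrow> ('m \<Rightarrow> 'v::real_vector) \<Rightarrow> 'm \<Rightarrow> 'v" (infixr "\<odot>" 75) where
  "f \<odot> s = (\<lambda>p. f p *\<^sub>R s p)"


section \<open>Multilinear maps\<close>

text \<open>
  Arguments of a \<open>k\<close>-ary map are lists of length \<open>k\<close>. A linear map on a \<open>k\<close>-th exterior power is
  encoded as the corresponding alternating \<open>k\<close>-linear map.
\<close>

definition tuples :: "nat \<Rightarrow> 'x set \<Rightarrow> 'x list set" where
  "tuples k S = {xs. length xs = k \<and> set xs \<subseteq> S}"

definition multilinear_map ::
  "nat \<Rightarrow> 'x::real_vector set \<Rightarrow> 'y::real_vector set \<Rightarrow> ('x list \<Rightarrow> 'y) \<Rightarrow> bool" where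
  "multilinear_map k S T D \<longleftrightarrow>
     D \<in> tuples k S \<rightarrow> T \<and>
     (\<forall>xs\<in>tuples k S. \<forall>i<k. \<forall>x\<in>S. \<forall>y\<in>S. D (xs[i := x + y]) = D (xs[i := x]) + D (xs[i := y])) \<and>
     (\<forall>xs\<in>tuples k S. \<forall>i<k. \<forall>x\<in>S. \<forall>c. D (xs[i := c *\<^sub>R x]) = c *\<^sub>R D (xs[i := x]))"

definition alternating :: "nat \<Rightarrow> 'x set \<Rightarrow> ('x list \<Rightarrow> 'y::real_vector) \<Rightarrow> bool" where
  "alternating k S D \<longleftrightarrow>
     (\<forall>xs\<in>tuples k S. \<forall>i<k. \<forall>j<k. i \<noteq> j \<and> xs ! i = xs ! j \<longrightarrow> D xs = 0)"

definition skew_symmetric :: "nat \<Rightarrow> 'x set \<Rightarrow> ('x list \<Rightarrow> 'y::real_vector) \<Rightarrow> bool" where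
  "skew_symmetric k S D \<longleftrightarrow>
     (\<forall>xs\<in>tuples k S. \<forall>i<k. \<forall>j<k. i \<noteq> j \<longrightarrow> D (xs[i := xs ! j, j := xs ! i]) = - D xs)"


section \<open>Filippov algebras and Filippov algebroids\<close>

definition filippov_algebra :: "nat \<Rightarrow> 'x::real_vector set \<Rightarrow> ('x list \<Rightarrow> 'x) \<Rightarrow> bool" where
  "filippov_algebra n L br \<longleftrightarrow>
     subspace L \<and> multilinear_map n L L br \<and> skew_symmetric n L br \<and>
     (\<forall>a\<in>tuples (n - 1) L. \<forall>b\<in>tuples n L.
        br (a @ [br b]) = (\<Sum>i<n. br (b[i := br (a @ [b ! i])])))"

text \<open>
  A bundle map \<open>\<And>\<^sup>kA \<rightarrow> TM\<close> over the identity: linear on each fibre, and smooth, i.e. carrying smooth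
  local sections to smooth local vector fields. It is \<open>undefined\<close> outside the fibres, so that
  equality of such maps is equality in HOL.
\<close>

definition exterior_bundle_map ::
  "('m::topological_space, 'e::euclidean_space) atlas \<Rightarrow> ('m \<Rightarrow> 'v::real_vector set) \<Rightarrow>
   ('m, 'v, 'f::euclidean_space) trivializations \<Rightarrow> nat \<Rightarrow>
   ('m \<Rightarrow> 'v list \<Rightarrow> ('m \<Rightarrow> real) \<Rightarrow> real) \<Rightarrow> bool" where
  "exterior_bundle_map At A Tr k a \<longleftrightarrow>
     (\<forall>p. a p \<in> extensional (tuples k (A p)) \<and>
          multilinear_map k (A p) (tangent_space At p) (a p) \<and> alternating k (A p) (a p)) \<and>
     (\<forall>W X. open W \<and> X \<in> tuples k {s. smooth_section_on At A Tr W s} \<longrightarrow>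
        (\<forall>f\<in>smooth_functions At. smooth_map_on At W (\<lambda>p. a p (map (\<lambda>x. x p) X) f)))"

definition on_sections ::
  "('m \<Rightarrow> 'v list \<Rightarrow> ('m \<Rightarrow> real) \<Rightarrow> real) \<Rightarrow> ('m \<Rightarrow> 'v) list \<Rightarrow> 'm \<Rightarrow> ('m \<Rightarrow> real) \<Rightarrow> real" where
  "on_sections a X = (\<lambda>p. a p (map (\<lambda>x. x p) X))"

definition filippov_algebroid_structures ::
  "('m::topological_space, 'e::euclidean_space) atlas \<Rightarrow> ('m \<Rightarrow> 'v::real_vector set) \<Rightarrow>
   ('m, 'v, 'f::euclidean_space) trivializations \<Rightarrow> nat \<Rightarrow>
   ((('m \<Rightarrow> 'v) list \<Rightarrow> 'm \<Rightarrow> 'v) \<times> ('m \<Rightarrow> 'v list \<Rightarrow> ('m \<Rightarrow> real) \<Rightarrow> real)) set" where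
  "filippov_algebroid_structures At A Tr n =
     (let \<Gamma> = smooth_sections At A Tr in
      {(br, a).
         br \<in> extensional (tuples n \<Gamma>) \<and> filippov_algebra n \<Gamma> br \<and>
         exterior_bundle_map At A Tr (n - 1) a \<and>
         (\<forall>X\<in>tuples (n - 1) \<Gamma>. \<forall>Y\<in>tuples (n - 1) \<Gamma>.
            lie_bracket (on_sections a X) (on_sections a Y) =
              (\<Sum>i<n - 1. on_sections a (Y[i := br (X @ [Y ! i])]))) \<and>
         (\<forall>X\<in>tuples (n - 1) \<Gamma>. \<forall>y\<in>\<Gamma>. \<forall>f\<in>smooth_functions At.
            br (X @ [f \<odot> y]) = f \<odot> br (X @ [y]) + (\<lambda>p. on_sections a X p f) \<odot> y)})"


section \<open>Filippov multiderivations of degree 1\<close>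

definition is_symbol ::
  "('m::topological_space, 'e::euclidean_space) atlas \<Rightarrow> ('m \<Rightarrow> 'v::real_vector) set \<Rightarrow> nat \<Rightarrow>
   (('m \<Rightarrow> 'v) list \<Rightarrow> 'm \<Rightarrow> 'v) \<Rightarrow> (('m \<Rightarrow> 'v) list \<Rightarrow> 'm \<Rightarrow> ('m \<Rightarrow> real) \<Rightarrow> real) \<Rightarrow> bool" where
  "is_symbol At \<Gamma> n D \<sigma> \<longleftrightarrow>
     multilinear_map (n - 1) \<Gamma> (vector_fields At) \<sigma> \<and> alternating (n - 1) \<Gamma> \<sigma> \<and>
     (\<forall>X\<in>tuples (n - 1) \<Gamma>. \<forall>i<n - 1. \<forall>x\<in>\<Gamma>. \<forall>f\<in>smooth_functions At.
        \<sigma> (X[i := f \<odot> x]) = f \<odot> \<sigma> (X[i := x])) \<and>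
     (\<forall>X\<in>tuples (n - 1) \<Gamma>. \<forall>f\<in>smooth_functions At. \<forall>z\<in>\<Gamma>.
        D (X @ [f \<odot> z]) = f \<odot> D (X @ [z]) + (\<lambda>p. \<sigma> X p f) \<odot> z)"

definition Der1 ::
  "('m::topological_space, 'e::euclidean_space) atlas \<Rightarrow> ('m \<Rightarrow> 'v::real_vector set) \<Rightarrow>
   ('m, 'v, 'f::euclidean_space) trivializations \<Rightarrow> nat \<Rightarrow> (('m \<Rightarrow> 'v) list \<Rightarrow> 'm \<Rightarrow> 'v) set" where
  "Der1 At A Tr n =
     (let \<Gamma> = smooth_sections At A Tr in
      {D. D \<in> extensional (tuples n \<Gamma>) \<and> multilinear_map n \<Gamma> \<Gamma> D \<and> alternating n \<Gamma> D \<and>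
          (\<exists>\<sigma>. is_symbol At \<Gamma> n D \<sigma>)})"

definition der_comp ::
  "nat \<Rightarrow> ('x list \<Rightarrow> 'x::real_vector) \<Rightarrow> ('x list \<Rightarrow> 'x) \<Rightarrow> 'x list \<Rightarrow> 'x list \<Rightarrow> 'x \<Rightarrow> 'x" where
  "der_comp n D1 D2 X1 X2 z =
     (\<Sum>s<n - 1. D1 (X2[s := D2 (X1 @ [X2 ! s])] @ [z]))
     - D1 (X1 @ [D2 (X2 @ [z])]) + D1 (X2 @ [D2 (X1 @ [z])])"

definition der_bracket ::
  "nat \<Rightarrow> ('x list \<Rightarrow> 'x::real_vector) \<Rightarrow> ('x list \<Rightarrow> 'x) \<Rightarrow> 'x list \<Rightarrow> 'x list \<Rightarrow> 'x \<Rightarrow> 'x" where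
  "der_bracket n D1 D2 X1 X2 z = - der_comp n D1 D2 X1 X2 z - der_comp n D2 D1 X1 X2 z"

text \<open>The elements \<open>\<phi>\<close> with \<open>[\<phi>, \<phi>] = 0\<close>, tested on decomposable elements, which span.\<close>

definition maurer_cartan_elements ::
  "('m::topological_space, 'e::euclidean_space) atlas \<Rightarrow> ('m \<Rightarrow> 'v::real_vector set) \<Rightarrow>
   ('m, 'v, 'f::euclidean_space) trivializations \<Rightarrow> nat \<Rightarrow> (('m \<Rightarrow> 'v) list \<Rightarrow> 'm \<Rightarrow> 'v) set" where
  "maurer_cartan_elements At A Tr n =
     {\<phi> \<in> Der1 At A Tr n.
        \<forall>X1\<in>tuples (n - 1) (smooth_sections At A Tr). \<forall>X2\<in>tuples (n - 1) (smooth_sections At A Tr).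
          \<forall>z\<in>smooth_sections At A Tr. der_bracket n \<phi> \<phi> X1 X2 z = 0}"

end

theory Submission
  imports Defs
begin

text \<open>
  The symbol of \<open>\<phi>\<close> plays the role of the anchor. Being \<open>C\<^sup>\<infinity>(M)\<close>-multilinear on sections, it is
  tensorial: cutoff functions and local frames show that its value at \<open>p\<close> depends only on the
  values of its arguments at \<open>p\<close>, so it comes from a bundle map. On decomposable elements,
  \<open>[\<phi>, \<phi>] = 0\<close> is the fundamental identity, up to the factor \<open>-2\<close>; together with the Leibniz
  rule it forces the symbol to respect brackets. The anchor is determined by the bracket through the
  Leibniz rule wherever the fibre is nonzero, and both sides of every identity between anchors vanish
  over the points with zero fibre, because \<open>n - 1 \<ge> 1\<close>.
\<close>


section \<open>Calculus of smooth maps\<close>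

text \<open>The correspondence forgets the anchor. A structure carries its anchor as data, while
  \<open>Der1\<close> only asserts that some symbol exists, so bijectivity of \<open>fst\<close>
  means that a suitable anchor exists and is unique. The obstacle is a change of domain: a symbol
  takes global sections, an anchor takes vectors of a single fibre. Every vector must extend to a
  global section, and the result must not depend on the extension; both rest on smooth functions
  that are 1 near a point and supported in a trivializing set, built here from
  \<open>exp (- 1 / t)\<close>. The anchor respects brackets for the following reason. For fixed
  \<open>X\<close>, \<open>D (X @ [z])\<close> is a first-order operator in \<open>z\<close> with
  leading part \<open>\<sigma> X\<close>. The fundamental identity writes the commutator of two such
  operators as a sum of such operators, and comparing leading parts gives the Lie bracket.\<close>

lemma Ck_on_cong:
  fixes f g :: "'a::euclidean_space \<Rightarrow> 'b::real_normed_vector"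
  assumes "Ck_on k W f" and "open W" and "\<And>x. x \<in> W \<Longrightarrow> f x = g x"
  shows "Ck_on k W g"
  using assms
proof (induction k arbitrary: f g)
  case 0
  then show ?case
    by (metis Ck_on.simps(1) continuous_on_cong)
next
  case (Suc k)
  have g: "(g has_derivative frechet_derivative f (at x)) (at x)" if "x \<in> W" for x
  proof (rule has_derivative_transform_within_open[OF _ \<open>open W\<close> that])
    show "(f has_derivative frechet_derivative f (at x)) (at x)"
      using Suc.prems(1) that by (simp add: frechet_derivative_works[symmetric])
  qed (use Suc.prems in auto)
  have "Ck_on k W (\<lambda>x. frechet_derivative g (at x) v)" for v
    by (rule Suc.IH[of "\<lambda>x. frechet_derivative f (at x) v"])
      (use Suc.prems frechet_derivative_at[OF g] in auto)
  then show ?case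
    using g by (auto simp: differentiable_def)
qed

text \<open>Regularity proofs can thus work with an explicit derivative formula: derivatives at a
  point are unique, so the formula agrees with \<open>frechet_derivative\<close> on
  \<open>W\<close>.\<close>

lemma Ck_on_SucI:
  fixes f :: "'a::euclidean_space \<Rightarrow> 'b::real_normed_vector"
  assumes "open W" and "\<And>x. x \<in> W \<Longrightarrow> (f has_derivative f' x) (at x)"
    and "\<And>v. Ck_on k W (\<lambda>x. f' x v)"
  shows "Ck_on (Suc k) W f"
proof -
  have "Ck_on k W (\<lambda>x. frechet_derivative f (at x) v)" for v
    using frechet_derivative_at[OF assms(2)] by (auto intro: Ck_on_cong[OF assms(3)[of v] \<open>open W\<close>])
  then show ?thesis
    using assms(2) by (auto simp: differentiable_def)
qed

lemma Ck_on_SucE: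
  fixes f :: "'a::euclidean_space \<Rightarrow> 'b::real_normed_vector"
  assumes "Ck_on (Suc k) W f"
  obtains f' where "\<And>x. x \<in> W \<Longrightarrow> (f has_derivative f' x) (at x)" and "\<And>v. Ck_on k W (\<lambda>x. f' x v)"
proof
  show "(f has_derivative frechet_derivative f (at x)) (at x)" if "x \<in> W" for x
    using assms that by (simp add: frechet_derivative_works[symmetric])
  show "Ck_on k W (\<lambda>x. frechet_derivative f (at x) v)" for v
    using assms by simp
qed

text \<open>The product and chain rules produce derivatives that still contain the original
  functions, so the inductions have to lower their class by one.\<close>

lemma Ck_on_pred: "Ck_on (Suc k) W f \<Longrightarrow> Ck_on k W f"
proof (induction k arbitrary: f)
  case 0
  then show ?case
    by (simp add: continuous_at_imp_continuous_on differentiable_imp_continuous_within)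
next
  case (Suc k)
  show ?case
    using Suc.prems Suc.IH by (metis Ck_on.simps(2))
qed

lemma Ck_on_subset:
  assumes "Ck_on k W f" and "V \<subseteq> W"
  shows "Ck_on k V f"
  using assms by (induction k arbitrary: f) (auto intro: continuous_on_subset)

lemma Ck_on_const: "open W \<Longrightarrow> Ck_on k W (\<lambda>x. c)"
proof (induction k arbitrary: c)
  case (Suc k)
  then show ?case
    by (intro Ck_on_SucI[where f'="\<lambda>x v. 0"]) auto
qed simp

lemma Ck_on_add:
  assumes "Ck_on k W f" and "Ck_on k W g" and "open W"
  shows "Ck_on k W (\<lambda>x. f x + g x)"
  using assms
proof (induction k arbitrary: f g)
  case 0
  then show ?case by (simp add: continuous_on_add)
next
  case (Suc k)
  obtain f' where f': "\<And>x. x \<in> W \<Longrightarrow> (f has_derivative f' x) (at x)" "\<And>v. Ck_on k W (\<lambda>x. f' x v)"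
    using Suc.prems(1) by (rule Ck_on_SucE) blast
  obtain g' where g': "\<And>x. x \<in> W \<Longrightarrow> (g has_derivative g' x) (at x)" "\<And>v. Ck_on k W (\<lambda>x. g' x v)"
    using Suc.prems(2) by (rule Ck_on_SucE) blast
  show ?case
    by (rule Ck_on_SucI[where f'="\<lambda>x v. f' x v + g' x v"])
      (use Suc f' g' in \<open>auto intro: has_derivative_add\<close>)
qed

text \<open>One induction for all bounded bilinear maps covers products, scaling and inner
  products.\<close>

lemma (in bounded_bilinear) Ck_on_prod:
  assumes "Ck_on k W f" and "Ck_on k W g" and "open W"
  shows "Ck_on k W (\<lambda>x. prod (f x) (g x))"
  using assms
proof (induction k arbitrary: f g)
  case 0
  then show ?case by (simp add: continuous_on)
next
  case (Suc k)
  obtain f' where f': "\<And>x. x \<in> W \<Longrightarrow> (f has_derivative f' x) (at x)" "\<And>v. Ck_on k W (\<lambda>x. f' x v)"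
    using Suc.prems(1) by (rule Ck_on_SucE) blast
  obtain g' where g': "\<And>x. x \<in> W \<Longrightarrow> (g has_derivative g' x) (at x)" "\<And>v. Ck_on k W (\<lambda>x. g' x v)"
    using Suc.prems(2) by (rule Ck_on_SucE) blast
  show ?case
    by (rule Ck_on_SucI[where f'="\<lambda>x v. prod (f x) (g' x v) + prod (f' x v) (g x)"])
      (use Suc.IH Suc.prems(1,2)[THEN Ck_on_pred] \<open>open W\<close> f' g' in \<open>auto intro!: FDERIV Ck_on_add\<close>)
qed

section \<open>A smooth function vanishing on a half-line\<close>

text \<open>This family of smooth functions contains \<open>exp (- 1 / t)\<close>, extended by \<open>0\<close>, and is closed under
  differentiation, so that a single induction makes all its members \<open>C\<^sup>k\<close> for every \<open>k\<close>, even after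
  composition with a smooth function.\<close>

definition flat :: "real poly \<Rightarrow> real \<Rightarrow> real" where
  "flat p t = (if t > 0 then poly p (1 / t) * exp (- 1 / t) else 0)"

text \<open>Substituting \<open>x = 1 / t\<close> reduces this to the fact that \<open>exp\<close>
  outgrows every polynomial.\<close>

lemma flat_tendsto_0: "((\<lambda>t::real. poly p (1 / t) * exp (- 1 / t)) \<longlongrightarrow> 0) (at_right 0)"
proof -
  have "((\<lambda>x::real. \<Sum>i\<le>degree p. coeff p i * (x ^ i / exp x)) \<longlongrightarrow> (\<Sum>i\<le>degree p. coeff p i * 0)) at_top"
    by (intro tendsto_intros tendsto_power_div_exp_0)
  then have "((\<lambda>x. poly p x / exp x) \<longlongrightarrow> 0) at_top"
    by (simp add: poly_altdef sum_divide_distrib)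
  then have "((\<lambda>t. poly p (inverse t) / exp (inverse t)) \<longlongrightarrow> 0) (at_right 0)"
    by (rule filterlim_compose) (rule filterlim_inverse_at_top_right)
  then show ?thesis
    by (simp add: exp_minus divide_inverse)
qed

text \<open>For \<open>t > 0\<close>, differentiating \<open>p(1/t) exp(-1/t)\<close> gives
  \<open>(1/t)^2 (p - p')(1/t) exp(-1/t)\<close>; this is where the polynomial on the right comes
  from. At 0 both one-sided difference quotients tend to 0.\<close>

lemma DERIV_flat: "(flat p has_real_derivative flat (monom 1 2 * (p - pderiv p)) t) (at t)"
proof -
  consider "t > 0" | "t < 0" | "t = 0" by linarith
  then show ?thesis
  proof cases
    case 1
    have "((\<lambda>t. poly p (1 / t) * exp (- 1 / t)) has_real_derivative
        flat (monom 1 2 * (p - pderiv p)) t) (at t)"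
      using 1 by (auto intro!: derivative_eq_intros
          simp: flat_def poly_monom field_simps power2_eq_square)
    then show ?thesis
      by (rule has_field_derivative_transform_within_open[where S="{0<..}"]) (use 1 in \<open>auto simp: flat_def\<close>)
  next
    case 2
    have "((\<lambda>t. 0) has_real_derivative flat (monom 1 2 * (p - pderiv p)) t) (at t)"
      using 2 by (simp add: flat_def)
    then show ?thesis
      by (rule has_field_derivative_transform_within_open[where S="{..<0}"]) (use 2 in \<open>auto simp: flat_def\<close>)
  next
    case 3
    have "((\<lambda>h. (flat p (0 + h) - flat p 0) / h) \<longlongrightarrow> 0) (at 0)"
    proof (rule filterlim_split_at)
      \<comment> \<open>Division by \<open>h\<close> multiplies the polynomial in
        \<open>1 / h\<close> by its variable, hence \<open>pCons 0 p\<close>.\<close>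
      have "((\<lambda>h. poly (pCons 0 p) (1 / h) * exp (- 1 / h)) \<longlongrightarrow> 0) (at_right (0::real))"
        by (rule flat_tendsto_0)
      then show "((\<lambda>h. (flat p (0 + h) - flat p 0) / h) \<longlongrightarrow> 0) (at_right 0)"
        by (rule Lim_transform_eventually)
          (auto simp: flat_def eventually_at_filter)
      show "((\<lambda>h. (flat p (0 + h) - flat p 0) / h) \<longlongrightarrow> 0) (at_left 0)"
        by (rule tendsto_eventually) (auto simp: flat_def eventually_at_filter)
    qed
    then show ?thesis
      using 3 by (simp add: DERIV_def flat_def)
  qed
qed

lemma Ck_on_flat:
  assumes "Ck_on k W g" and "open W"
  shows "Ck_on k W (\<lambda>x. flat p (g x))"
  using assms(1)
proof (induction k arbitrary: p)
  case 0
  have "continuous_on UNIV (flat p)"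
    using DERIV_flat DERIV_isCont by (blast intro: continuous_at_imp_continuous_on)
  then show ?case
    using 0 by (auto intro: continuous_on_compose2)
next
  case (Suc k)
  obtain g' where g': "\<And>x. x \<in> W \<Longrightarrow> (g has_derivative g' x) (at x)" "\<And>v. Ck_on k W (\<lambda>x. g' x v)"
    using Suc.prems(1) by (rule Ck_on_SucE) blast
  let ?q = "monom 1 2 * (p - pderiv p)"
  show ?case
  proof (rule Ck_on_SucI[where f'="\<lambda>x v. flat ?q (g x) * g' x v"])
    show "((\<lambda>x. flat p (g x)) has_derivative (\<lambda>v. flat ?q (g x) * g' x v)) (at x)" if "x \<in> W" for x
      using has_derivative_compose[OF g'(1)[OF that] DERIV_flat[unfolded has_field_derivative_def]] .
    show "Ck_on k W (\<lambda>x. flat ?q (g x) * g' x v)" for v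
      using Suc.IH[OF Ck_on_pred[OF Suc.prems]] g'(2) \<open>open W\<close>
      by (rule bounded_bilinear.Ck_on_prod[OF bounded_bilinear_mult])
  qed (fact assms(2))
qed

section \<open>Smoothness on arbitrary subsets of a Euclidean space\<close>

lemma smooth_onE:
  assumes "smooth_on S f" and "x \<in> S"
  obtains W g where "open W" "x \<in> W" "\<And>k. Ck_on k W g" "\<And>y. y \<in> W \<Longrightarrow> y \<in> S \<Longrightarrow> g y = f y"
  using bspec[OF assms(1)[unfolded smooth_on_def] assms(2)] by (elim exE conjE) (auto intro: that)

lemma smooth_on_subset:
  assumes "smooth_on S f" and "T \<subseteq> S"
  shows "smooth_on T f"
  unfolding smooth_on_def
proof
  fix x assume "x \<in> T"
  then have "x \<in> S" using assms(2) by blast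
  then obtain W g where "open W" "x \<in> W" "\<And>k. Ck_on k W g" "\<And>y. y \<in> W \<Longrightarrow> y \<in> S \<Longrightarrow> g y = f y"
    by (rule smooth_onE[OF assms(1)]) (rule that)
  then show "\<exists>W g. open W \<and> x \<in> W \<and> (\<forall>k. Ck_on k W g) \<and> (\<forall>y\<in>W \<inter> T. g y = f y)"
    using assms(2) by (intro exI[of _ W] exI[of _ g]) auto
qed

lemma smooth_on_cong: "smooth_on S f \<Longrightarrow> (\<And>x. x \<in> S \<Longrightarrow> f x = g x) \<Longrightarrow> smooth_on S g"
  unfolding smooth_on_def by simp

lemma smooth_on_const: "smooth_on S (\<lambda>x. c)"
  unfolding smooth_on_def
  by (intro ballI exI[of _ UNIV] exI[of _ "\<lambda>x. c"]) (simp add: Ck_on_const)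

text \<open>Extensions of \<open>f\<close> and \<open>g\<close> live on different neighbourhoods and
  are combined on the intersection. It then suffices that \<open>H\<close> preserves each class on
  open sets.\<close>

lemma smooth_on_combine:
  fixes f :: "'a::euclidean_space \<Rightarrow> 'b::real_normed_vector" and g :: "'a \<Rightarrow> 'c::real_normed_vector"
  assumes f: "smooth_on S f" and g: "smooth_on S g"
    and H: "\<And>k W (f::'a \<Rightarrow> 'b) g. Ck_on k W f \<Longrightarrow> Ck_on k W g \<Longrightarrow> open W \<Longrightarrow> Ck_on k W (\<lambda>x. H (f x) (g x))"
  shows "smooth_on S (\<lambda>x. H (f x) (g x))"
  unfolding smooth_on_def
proof
  fix x assume x: "x \<in> S"
  obtain V f1 where f1: "open V" "x \<in> V" "\<And>k. Ck_on k V f1" "\<And>y. y \<in> V \<Longrightarrow> y \<in> S \<Longrightarrow> f1 y = f y"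
    by (rule smooth_onE[OF f x]) (rule that)
  obtain W g1 where g1: "open W" "x \<in> W" "\<And>k. Ck_on k W g1" "\<And>y. y \<in> W \<Longrightarrow> y \<in> S \<Longrightarrow> g1 y = g y"
    by (rule smooth_onE[OF g x]) (rule that)
  have "Ck_on k (V \<inter> W) (\<lambda>x. H (f1 x) (g1 x))" for k
    by (rule H) (use f1 g1 in \<open>auto intro: Ck_on_subset\<close>)
  then show "\<exists>W h. open W \<and> x \<in> W \<and> (\<forall>k. Ck_on k W h) \<and> (\<forall>y\<in>W \<inter> S. h y = H (f y) (g y))"
    by (intro exI[of _ "V \<inter> W"] exI[of _ "\<lambda>x. H (f1 x) (g1 x)"]) (use f1 g1 in auto)
qed

lemma smooth_on_add: "smooth_on S f \<Longrightarrow> smooth_on S g \<Longrightarrow> smooth_on S (\<lambda>x. f x + g x)"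
  by (erule (1) smooth_on_combine[where H="(+)"]) (rule Ck_on_add)

lemma (in bounded_bilinear) smooth_on_prod:
  "smooth_on S f \<Longrightarrow> smooth_on S g \<Longrightarrow> smooth_on S (\<lambda>x. prod (f x) (g x))"
  by (erule (1) smooth_on_combine[where H=prod]) (rule Ck_on_prod)

lemma smooth_on_flat: "smooth_on S f \<Longrightarrow> smooth_on S (\<lambda>x. flat p (f x))"
  \<comment> \<open>A unary operation is treated as a binary one, with \<open>f\<close> in both
    places.\<close>
  by (rule smooth_on_combine[where H="\<lambda>s t. flat p s" and g=f]) (simp_all add: Ck_on_flat)

lemma smooth_on_imp_continuous_on:
  assumes "smooth_on S f"
  shows "continuous_on S f"
  unfolding continuous_on_def
proof
  fix x assume x: "x \<in> S"
  obtain W g where *: "open W" "x \<in> W" "\<And>k. Ck_on k W g" "\<And>y. y \<in> W \<Longrightarrow> y \<in> S \<Longrightarrow> g y = f y"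
    by (rule smooth_onE[OF assms x]) (rule that)
  have "(g \<longlongrightarrow> g x) (at x)"
    using *(1,2) *(3)[of 0] by (simp add: continuous_on_eq_continuous_at isCont_def)
  then have "(g \<longlongrightarrow> f x) (at x within S)"
    using tendsto_within_subset[of g "nhds (g x)" x UNIV S] *(2,4) x by simp
  moreover have "\<forall>\<^sub>F y in at x within S. g y = f y"
    using * by (auto simp: eventually_at_topological)
  ultimately show "(f \<longlongrightarrow> f x) (at x within S)"
    by (rule Lim_transform_eventually)
qed


section \<open>Smooth functions on a manifold\<close>

lemma smooth_map_on_subset: "smooth_map_on At W f \<Longrightarrow> V \<subseteq> W \<Longrightarrow> smooth_map_on At V f"
  unfolding smooth_map_on_def by (force intro: smooth_on_subset)

lemma smooth_map_on_const: "smooth_map_on At W (\<lambda>q. c)"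
  unfolding smooth_map_on_def by (auto simp: o_def smooth_on_const)

lemma smooth_map_on_add:
  "smooth_map_on At W f \<Longrightarrow> smooth_map_on At W g \<Longrightarrow> smooth_map_on At W (\<lambda>q. f q + g q)"
  unfolding smooth_map_on_def o_def by (fast intro: smooth_on_add)

lemma (in bounded_bilinear) smooth_map_on_prod:
  "smooth_map_on At W f \<Longrightarrow> smooth_map_on At W g \<Longrightarrow> smooth_map_on At W (\<lambda>q. prod (f q) (g q))"
  unfolding smooth_map_on_def o_def by (fast intro: smooth_on_prod)

lemmas smooth_map_on_mult = bounded_bilinear.smooth_map_on_prod[OF bounded_bilinear_mult]
lemmas smooth_map_on_scaleR = bounded_bilinear.smooth_map_on_prod[OF bounded_bilinear_scaleR]
lemmas smooth_map_on_inner = bounded_bilinear.smooth_map_on_prod[OF bounded_bilinear_inner]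

lemma smooth_map_on_flat: "smooth_map_on At W f \<Longrightarrow> smooth_map_on At W (\<lambda>q. flat p (f q))"
  unfolding smooth_map_on_def o_def by (fast intro: smooth_on_flat)

locale manifold =
  fixes E :: "'e::euclidean_space set"
    and At :: "('m::{t2_space, second_countable_topology}, 'e) atlas"
  assumes manifold: "smooth_manifold E At"
begin

text \<open>The manifold axioms only provide some inverse homeomorphism, whereas smoothness is
  expressed by \<open>inv_into\<close>; the two agree on the chart image, so continuity carries
  over.\<close>

lemma chart:
  assumes "(U, \<phi>) \<in> At"
  shows "open U" and "openin (top_of_set E) (\<phi> ` U)" and "inj_on \<phi> U"
    and "continuous_on U \<phi>" and "continuous_on (\<phi> ` U) (inv_into U \<phi>)"
proof -
  obtain \<psi> where \<psi>: "homeomorphism U (\<phi> ` U) \<phi> \<psi>"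
    using assms manifold unfolding smooth_manifold_def by fast
  show "open U" and "openin (top_of_set E) (\<phi> ` U)"
    using assms manifold unfolding smooth_manifold_def by fast+
  show inj: "inj_on \<phi> U" and "continuous_on U \<phi>"
    using \<psi> by (auto simp: homeomorphism_def inj_on_def) metis
  have "inv_into U \<phi> y = \<psi> y" if "y \<in> \<phi> ` U" for y
    using that inj \<psi> by (auto simp: homeomorphism_def)
  then show "continuous_on (\<phi> ` U) (inv_into U \<phi>)"
    using \<psi> by (simp add: homeomorphism_def cong: continuous_on_cong)
qed

lemma chart_at:
  obtains U \<phi> where "(U, \<phi>) \<in> At" and "p \<in> U"
proof -
  have "p \<in> (\<Union>(U, \<phi>)\<in>At. U)"
    using manifold by (simp add: smooth_manifold_def)
  then show ?thesis
    using that by blast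
qed

text \<open>An open set of the ambient space is what local extensions call for: their domains can be
  shrunk by intersecting with \<open>Q\<close>.\<close>

lemma chart_image_open:
  assumes "(U, \<phi>) \<in> At" and "open W"
  obtains Q where "open Q" and "\<phi> ` (U \<inter> W) = \<phi> ` U \<inter> Q"
proof -
  have "openin (top_of_set (\<phi> ` U)) (\<phi> ` U \<inter> inv_into U \<phi> -` W)"
    using chart(5)[OF assms(1)] assms(2) by (rule continuous_openin_preimage_gen)
  moreover have "\<phi> ` U \<inter> inv_into U \<phi> -` W = \<phi> ` (U \<inter> W)"
    using chart(3)[OF assms(1)] by auto
  ultimately show ?thesis
    using that by (auto simp: openin_open)
qed

lemma smooth_map_on_chart: "(U, \<phi>) \<in> At \<Longrightarrow> smooth_map_on At U \<phi>"
  using manifold unfolding smooth_manifold_def smooth_map_on_def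
  by (auto simp: Int_commute)

lemma smooth_map_on_cong:
  assumes "smooth_map_on At W f" and "\<And>q. q \<in> W \<Longrightarrow> f q = g q"
  shows "smooth_map_on At W g"
  unfolding smooth_map_on_def
proof clarify
  fix U \<phi> assume U: "(U, \<phi>) \<in> At"
  then have "smooth_on (\<phi> ` (U \<inter> W)) (f \<circ> inv_into U \<phi>)"
    using assms(1) by (auto simp: smooth_map_on_def)
  then show "smooth_on (\<phi> ` (U \<inter> W)) (g \<circ> inv_into U \<phi>)"
    by (rule smooth_on_cong) (use assms(2) chart(3)[OF U] in auto)
qed

text \<open>A local extension found for \<open>V \<inter> W\<close> also serves for \<open>W\<close>
  once its domain is shrunk to \<open>Q\<close>: by injectivity of the chart, its image points in
  \<open>Q\<close> come only from \<open>V\<close>.\<close>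

lemma smooth_map_on_locally:
  assumes "\<And>p. p \<in> W \<Longrightarrow> \<exists>V. open V \<and> p \<in> V \<and> smooth_map_on At (V \<inter> W) f"
  shows "smooth_map_on At W f"
  unfolding smooth_map_on_def
proof clarify
  fix U \<phi> assume U: "(U, \<phi>) \<in> At"
  show "smooth_on (\<phi> ` (U \<inter> W)) (f \<circ> inv_into U \<phi>)"
    unfolding smooth_on_def
  proof clarify
    fix p assume p: "p \<in> U" "p \<in> W"
    obtain V where V: "open V" "p \<in> V" "smooth_map_on At (V \<inter> W) f"
      using assms[OF p(2)] by blast
    have *: "smooth_on (\<phi> ` (U \<inter> (V \<inter> W))) (f \<circ> inv_into U \<phi>)"
      using V(3) U by (auto simp: smooth_map_on_def)
    obtain N g where N: "open N" "\<phi> p \<in> N" "\<And>k. Ck_on k N g"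
      and g: "\<And>y. y \<in> N \<Longrightarrow> y \<in> \<phi> ` (U \<inter> (V \<inter> W)) \<Longrightarrow> g y = (f \<circ> inv_into U \<phi>) y"
      by (rule smooth_onE[OF *, of "\<phi> p"]) (use p V(2) that in auto)
    obtain Q where Q: "open Q" "\<phi> ` (U \<inter> V) = \<phi> ` U \<inter> Q"
      using chart_image_open[OF U V(1)] .
    have "\<phi> q \<in> \<phi> ` (U \<inter> (V \<inter> W))" if "q \<in> U" "q \<in> W" "\<phi> q \<in> Q" for q
    proof -
      have "\<phi> q \<in> \<phi> ` (U \<inter> V)"
        using Q(2) that by blast
      then have "q \<in> V"
        using chart(3)[OF U] that(1) by (auto dest: inj_onD)
      then show ?thesis
        using that by blast
    qed
    moreover have "\<phi> p \<in> Q"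
      using Q(2) p V(2) by blast
    ultimately show "\<exists>N g. open N \<and> \<phi> p \<in> N \<and> (\<forall>k. Ck_on k N g) \<and>
        (\<forall>y\<in>N \<inter> \<phi> ` (U \<inter> W). g y = (f \<circ> inv_into U \<phi>) y)"
      using N Q(1) g
      by (intro exI[of _ "N \<inter> Q"] exI[of _ g]) (auto intro: Ck_on_subset)
  qed
qed

section \<open>Bump and cutoff functions on the manifold\<close>

lemma smooth_map_on_imp_continuous_on:
  assumes "smooth_map_on At UNIV f"
  shows "continuous_on UNIV f"
proof (rule continuous_at_imp_continuous_on, rule ballI)
  fix p
  obtain U \<phi> where U: "(U, \<phi>) \<in> At" "p \<in> U"
    by (rule chart_at)
  have "smooth_on (\<phi> ` U) (f \<circ> inv_into U \<phi>)"
    using assms U(1) by (auto simp: smooth_map_on_def)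
  then have "continuous_on U ((f \<circ> inv_into U \<phi>) \<circ> \<phi>)"
    using chart(4)[OF U(1)] by (intro continuous_on_compose smooth_on_imp_continuous_on)
  then have "continuous_on U f"
    by (rule continuous_on_eq) (use chart(3)[OF U(1)] in auto)
  then show "isCont f p"
    using chart(1)[OF U(1)] U(2) by (simp add: continuous_on_eq_continuous_at)
qed

text \<open>In a chart, take \<open>flat 1\<close> of \<open>r^2\<close> minus the squared distance
  to \<open>\<phi> p\<close>, and extend by 0. The extension is smooth because it vanishes off the
  preimage \<open>K\<close> of a ball, which is compact, hence closed in the Hausdorff
  manifold.\<close>

lemma exists_positive_bump:
  assumes "open W" and "p \<in> W"
  obtains \<eta> :: "'m \<Rightarrow> real" and K
  where "smooth_map_on At UNIV \<eta>" and "\<eta> p > 0" and "closed K" and "K \<subseteq> W" and "\<And>q. q \<notin> K \<Longrightarrow> \<eta> q = 0"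
proof -
  obtain U \<phi> where U: "(U, \<phi>) \<in> At" "p \<in> U"
    by (rule chart_at)
  obtain Q where Q: "open Q" "\<phi> ` (U \<inter> W) = \<phi> ` U \<inter> Q"
    using chart_image_open[OF U(1) assms(1)] .
  obtain Q' where Q': "open Q'" "\<phi> ` U = E \<inter> Q'"
    using chart(2)[OF U(1)] by (auto simp: openin_open)
  have "\<phi> p \<in> Q \<inter> Q'"
    using Q(2) Q'(2) U(2) assms(2) by blast
  then obtain r where r: "r > 0" "cball (\<phi> p) r \<subseteq> Q \<inter> Q'"
    using open_contains_cball[of "Q \<inter> Q'"] Q(1) Q'(1) by blast
  \<comment> \<open>The chart image is open only relative to \<open>E\<close>, so the ball is cut
    down to the model space.\<close>
  define S where "S = E \<inter> cball (\<phi> p) r"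
  have S: "S \<subseteq> \<phi> ` (U \<inter> W)"
    using r(2) unfolding Q(2) Q'(2) S_def by blast
  have "compact S"
    unfolding S_def using manifold
    by (intro closed_Int_compact) (auto simp: smooth_manifold_def closed_subspace)
  define K where "K = inv_into U \<phi> ` S"
  have "compact K"
    unfolding K_def using chart(5)[OF U(1)] S \<open>compact S\<close>
    by (intro compact_continuous_image) (auto intro: continuous_on_subset)
  then have "closed K"
    by (rule compact_imp_closed)
  have "K \<subseteq> U \<inter> W"
    unfolding K_def using S chart(3)[OF U(1)] by fastforce
  \<comment> \<open>Differences are written with \<open>+\<close> and \<open>-1\<close> so that the
    closure rules for sums, products and inner products apply directly.\<close>
  define d where "d = (\<lambda>q. r\<^sup>2 + (-1) * ((\<phi> q + - \<phi> p) \<bullet> (\<phi> q + - \<phi> p)))"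
  define \<eta> where "\<eta> = (\<lambda>q. if q \<in> U then flat 1 (d q) else 0)"
  have zero: "\<eta> q = 0" if "q \<notin> K" for q
  proof (cases "q \<in> U")
    case True
    have "\<phi> q \<notin> S"
      using that True chart(3)[OF U(1)] unfolding K_def by (metis image_eqI inv_into_f_f)
    then have "r < dist (\<phi> p) (\<phi> q)"
      using True Q'(2) unfolding S_def by force
    then have "r\<^sup>2 < (dist (\<phi> q) (\<phi> p))\<^sup>2"
      using r(1) by (intro power_strict_mono) (auto simp: dist_commute)
    then have "d q < 0"
      by (simp add: d_def dist_norm power2_norm_eq_inner)
    then show ?thesis
      by (simp add: \<eta>_def flat_def)
  qed (simp add: \<eta>_def)
  have "smooth_map_on At UNIV \<eta>"
  proof (rule smooth_map_on_locally)
    fix q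
    show "\<exists>V. open V \<and> q \<in> V \<and> smooth_map_on At (V \<inter> UNIV) \<eta>"
    proof (cases "q \<in> U")
      case True
      have "smooth_map_on At U (\<lambda>q. flat 1 (d q))"
        unfolding d_def by (intro smooth_map_on_flat smooth_map_on_add smooth_map_on_mult
            smooth_map_on_inner smooth_map_on_const smooth_map_on_chart[OF U(1)])
      then have "smooth_map_on At U \<eta>"
        by (rule smooth_map_on_cong) (simp add: \<eta>_def)
      then show ?thesis
        using chart(1)[OF U(1)] True by auto
    next
      case False
      have "smooth_map_on At (- K) \<eta>"
        by (rule smooth_map_on_cong[OF smooth_map_on_const[of _ _ 0]]) (simp add: zero)
      then show ?thesis
        using \<open>closed K\<close> \<open>K \<subseteq> U \<inter> W\<close> False by (intro exI[of _ "- K"]) auto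
    qed
  qed
  moreover have "\<eta> p > 0"
    using U(2) r(1) by (simp add: \<eta>_def d_def flat_def)
  ultimately show ?thesis
    using that \<open>closed K\<close> \<open>K \<subseteq> U \<inter> W\<close> zero by blast
qed

text \<open>The closed set \<open>K\<close> confines the support to \<open>W\<close>. Vanishing off
  \<open>W\<close> alone would not make the product with a function smooth only on \<open>W\<close>
  smooth at the boundary of \<open>W\<close>.\<close>

definition cutoff :: "'m set \<Rightarrow> ('m \<Rightarrow> real) \<Rightarrow> bool" where
  "cutoff W \<eta> \<longleftrightarrow> smooth_map_on At UNIV \<eta> \<and> (\<exists>K. closed K \<and> K \<subseteq> W \<and> (\<forall>q. q \<notin> K \<longrightarrow> \<eta> q = 0))"

lemma cutoff_eq_0: "cutoff W \<eta> \<Longrightarrow> q \<notin> W \<Longrightarrow> \<eta> q = 0"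
  by (auto simp: cutoff_def)

lemma cutoff_smooth: "cutoff W \<eta> \<Longrightarrow> \<eta> \<in> smooth_functions At"
  by (simp add: cutoff_def smooth_functions_def)

text \<open>With \<open>\<eta>\<^sub>0\<close> positive at \<open>p\<close> and \<open>h = flat 1\<close>, the function \<open>h (c - \<eta>\<^sub>0)\<close> vanishes where \<open>\<eta>\<^sub>0 > c\<close>
  and is the constant \<open>h c\<close> where \<open>\<eta>\<^sub>0 = 0\<close>.\<close>

lemma exists_cutoff:
  assumes "open W" and "p \<in> W"
  obtains \<eta> V where "cutoff W \<eta>" and "open V" and "p \<in> V" and "V \<subseteq> W" and "\<And>q. q \<in> V \<Longrightarrow> \<eta> q = 1"
proof -
  obtain \<eta>\<^sub>0 :: "'m \<Rightarrow> real" and K where \<eta>\<^sub>0: "smooth_map_on At UNIV \<eta>\<^sub>0" "\<eta>\<^sub>0 p > 0"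
    and K: "closed K" "K \<subseteq> W" "\<And>q. q \<notin> K \<Longrightarrow> \<eta>\<^sub>0 q = 0"
    by (rule exists_positive_bump[OF assms]) (rule that)
  \<comment> \<open>Any value strictly between 0 and \<open>\<eta>\<^sub>0 p\<close> would
    do.\<close>
  define c where "c = \<eta>\<^sub>0 p / 2"
  have c: "0 < c" "c < \<eta>\<^sub>0 p"
    using \<eta>\<^sub>0(2) by (auto simp: c_def)
  define \<eta> where "\<eta> = (\<lambda>q. 1 + (- 1 / flat 1 c) * flat 1 (c + (- 1) * \<eta>\<^sub>0 q))"
  have "smooth_map_on At UNIV \<eta>"
    unfolding \<eta>_def
    by (intro smooth_map_on_flat smooth_map_on_add smooth_map_on_mult smooth_map_on_const \<eta>\<^sub>0(1))
  moreover have "\<eta> q = 0" if "q \<notin> K" for q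
    using K(3)[OF that] c(1) by (simp add: \<eta>_def flat_def)
  ultimately have cutoff: "cutoff W \<eta>"
    using K(1,2) by (auto simp: cutoff_def)
  let ?V = "{q. c < \<eta>\<^sub>0 q}"
  have "open ?V"
    using smooth_map_on_imp_continuous_on[OF \<eta>\<^sub>0(1)] by (intro open_Collect_less) auto
  moreover have "?V \<subseteq> W"
    using K c(1) by fastforce
  moreover have "\<eta> q = 1" if "q \<in> ?V" for q
    using that by (simp add: \<eta>_def flat_def)
  ultimately show ?thesis
    using cutoff c(2) by (intro that[of \<eta> ?V]) auto
qed

text \<open>Outside \<open>W\<close> the values of \<open>f\<close> are arbitrary, since \<open>\<eta>\<close> vanishes there.\<close>

lemma smooth_map_on_cutoff:
  assumes "cutoff W \<eta>" and "open W" and "smooth_map_on At (W \<inter> U) f"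
  shows "smooth_map_on At U (\<lambda>q. \<eta> q *\<^sub>R f q)"
proof (rule smooth_map_on_locally)
  fix q
  obtain K where K: "closed K" "K \<subseteq> W" "\<And>q. q \<notin> K \<Longrightarrow> \<eta> q = 0"
    using assms(1) by (auto simp: cutoff_def)
  have \<eta>: "smooth_map_on At V \<eta>" for V
    using assms(1) by (auto simp: cutoff_def intro: smooth_map_on_subset)
  show "\<exists>V. open V \<and> q \<in> V \<and> smooth_map_on At (V \<inter> U) (\<lambda>q. \<eta> q *\<^sub>R f q)"
  proof (cases "q \<in> W")
    case True
    then show ?thesis
      using assms(2) smooth_map_on_scaleR[OF \<eta> assms(3)] by blast
  next
    case False
    have "smooth_map_on At (- K \<inter> U) (\<lambda>q. \<eta> q *\<^sub>R f q)"
      by (rule smooth_map_on_cong[OF smooth_map_on_const[of _ _ 0]]) (simp add: K(3))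
    then show ?thesis
      using K False by (intro exI[of _ "- K"]) auto
  qed
qed

end


section \<open>Sections of a vector bundle\<close>

lemma smooth_functions_iff: "f \<in> smooth_functions At \<longleftrightarrow> smooth_map_on At UNIV f"
  by (simp add: smooth_functions_def)

lemma const_smooth: "(\<lambda>q. c) \<in> smooth_functions At"
  by (simp add: smooth_functions_iff smooth_map_on_const)

lemma smooth_functions_imp_on: "f \<in> smooth_functions At \<Longrightarrow> smooth_map_on At W f"
  unfolding smooth_functions_iff by (rule smooth_map_on_subset) auto

lemma sum_fun_apply: "(\<Sum>i\<in>I. f i) x = (\<Sum>i\<in>I. f i x)"
  by (induction I rule: infinite_finite_induct) auto

lemma fscale_apply [simp]: "(f \<odot> s) p = f p *\<^sub>R s p"
  by (simp add: fscale_def)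

locale smooth_bundle = manifold E At
  for E :: "'e::euclidean_space set"
    and At :: "('m::{t2_space, second_countable_topology}, 'e) atlas" +
  fixes F :: "'f::euclidean_space set"
    and A :: "'m \<Rightarrow> 'v::real_vector set"
    and Tr :: "('m, 'v, 'f) trivializations"
  assumes vector_bundle: "smooth_vector_bundle At F A Tr"
begin

abbreviation sections ("\<Gamma>") where "\<Gamma> \<equiv> smooth_sections At A Tr"

abbreviation scalars ("\<C>") where "\<C> \<equiv> smooth_functions At"

lemma fibre_subspace: "subspace (A p)"
  using vector_bundle by (simp add: smooth_vector_bundle_def)

lemma model_fibre_subspace: "subspace F"
  using vector_bundle by (simp add: smooth_vector_bundle_def)

lemma trivialization_at:
  obtains U \<tau> where "(U, \<tau>) \<in> Tr" and "p \<in> U"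
proof -
  have "p \<in> (\<Union>(U, \<tau>)\<in>Tr. U)"
    using vector_bundle by (simp add: smooth_vector_bundle_def)
  then show ?thesis
    using that by blast
qed

lemma trivialization_open: "(U, \<tau>) \<in> Tr \<Longrightarrow> open U"
  using vector_bundle unfolding smooth_vector_bundle_def by fast

context
  fixes U \<tau> p
  assumes U: "(U, \<tau>) \<in> Tr" "p \<in> U"
begin

lemma trivialization_bij: "bij_betw (\<tau> p) (A p) F"
  and trivialization_add: "v \<in> A p \<Longrightarrow> w \<in> A p \<Longrightarrow> \<tau> p (v + w) = \<tau> p v + \<tau> p w"
  and trivialization_scaleR: "v \<in> A p \<Longrightarrow> \<tau> p (c *\<^sub>R v) = c *\<^sub>R \<tau> p v"
  using vector_bundle U unfolding smooth_vector_bundle_def by fast+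

lemma trivialization_0: "\<tau> p 0 = 0"
  using trivialization_scaleR[of 0 0] fibre_subspace[of p] by (simp add: subspace_0)

lemma trivialization_sum:
  assumes "\<And>i. i \<in> I \<Longrightarrow> v i \<in> A p"
  shows "\<tau> p (\<Sum>i\<in>I. v i) = (\<Sum>i\<in>I. \<tau> p (v i))"
  using assms
  by (induction I rule: infinite_finite_induct)
    (auto simp: trivialization_0 trivialization_add subspace_sum fibre_subspace)

lemma trivialization_in: "v \<in> A p \<Longrightarrow> \<tau> p v \<in> F"
  using trivialization_bij by (auto simp: bij_betw_def)

lemma trivialization_inv:
  "w \<in> F \<Longrightarrow> inv_into (A p) (\<tau> p) w \<in> A p" "w \<in> F \<Longrightarrow> \<tau> p (inv_into (A p) (\<tau> p) w) = w"
  "v \<in> A p \<Longrightarrow> inv_into (A p) (\<tau> p) (\<tau> p v) = v"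
  using trivialization_bij by (auto simp: bij_betw_def inv_into_into f_inv_into_f)

end

section \<open>Local and global sections\<close>

lemma section_onD:
  assumes "smooth_section_on At A Tr W s"
  shows "p \<in> W \<Longrightarrow> s p \<in> A p" and "(U, \<tau>) \<in> Tr \<Longrightarrow> smooth_map_on At (U \<inter> W) (\<lambda>q. \<tau> q (s q))"
  using assms unfolding smooth_section_on_def by fast+

lemma sectionD:
  assumes "s \<in> \<Gamma>"
  shows "s p \<in> A p" and "(U, \<tau>) \<in> Tr \<Longrightarrow> smooth_map_on At U (\<lambda>q. \<tau> q (s q))"
    and "smooth_section_on At A Tr UNIV s"
  using assms section_onD[of UNIV s] by (auto simp: smooth_sections_def)

text \<open>The passage from local to global sections. Off \<open>W\<close> the values of
  \<open>s\<close> need not lie in the fibres, but there the product is 0, which lies in every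
  fibre.\<close>

lemma section_on_cutoff:
  assumes s: "smooth_section_on At A Tr W s" and "open W" and "cutoff W \<eta>"
  shows "\<eta> \<odot> s \<in> \<Gamma>"
proof -
  have "(\<eta> \<odot> s) q \<in> A q" for q
    using section_onD(1)[OF s, of q] cutoff_eq_0[OF assms(3), of q] fibre_subspace[of q]
    by (cases "q \<in> W") (auto simp: subspace_scale subspace_0)
  moreover have "smooth_map_on At U (\<lambda>q. \<tau> q ((\<eta> \<odot> s) q))" if U: "(U, \<tau>) \<in> Tr" for U \<tau>
  proof (rule smooth_map_on_cong)
    show "smooth_map_on At U (\<lambda>q. \<eta> q *\<^sub>R \<tau> q (s q))"
      using section_onD(2)[OF s U] by (intro smooth_map_on_cutoff[OF assms(3,2)]) (simp add: Int_commute)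
    show "\<eta> q *\<^sub>R \<tau> q (s q) = \<tau> q ((\<eta> \<odot> s) q)" if "q \<in> U" for q
      using section_onD(1)[OF s, of q] cutoff_eq_0[OF assms(3), of q]
        trivialization_scaleR[OF U that] trivialization_0[OF U that]
      by (cases "q \<in> W") auto
  qed
  ultimately show ?thesis
    by (auto simp: smooth_sections_def smooth_section_on_def)
qed

lemma section_add: "x \<in> \<Gamma> \<Longrightarrow> y \<in> \<Gamma> \<Longrightarrow> x + y \<in> \<Gamma>"
  unfolding smooth_sections_def smooth_section_on_def
  by (auto simp: trivialization_add subspace_add[OF fibre_subspace]
      intro: smooth_map_on_cong[OF smooth_map_on_add])

lemma section_fscale: "f \<in> \<C> \<Longrightarrow> x \<in> \<Gamma> \<Longrightarrow> f \<odot> x \<in> \<Gamma>"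
  unfolding smooth_sections_def smooth_section_on_def
  by (auto simp: trivialization_scaleR subspace_scale[OF fibre_subspace]
      intro: smooth_map_on_cong[OF smooth_map_on_scaleR[OF smooth_functions_imp_on]])

lemma section_0: "0 \<in> \<Gamma>"
  unfolding smooth_sections_def smooth_section_on_def
  by (auto simp: trivialization_0 subspace_0[OF fibre_subspace]
      intro: smooth_map_on_cong[OF smooth_map_on_const[of _ _ 0]])

lemma scaleR_eq_fscale: "c *\<^sub>R x = (\<lambda>q. c) \<odot> x"
  by (simp add: fun_eq_iff)

lemma section_scaleR: "x \<in> \<Gamma> \<Longrightarrow> c *\<^sub>R x \<in> \<Gamma>"
  by (simp add: scaleR_eq_fscale section_fscale const_smooth)

lemma subspace_sections: "subspace \<Gamma>"
  by (simp add: subspace_def section_0 section_add section_scaleR)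

text \<open>Smoothness of the transition functions is exactly what makes a section that is constant
  in one trivialization smooth in the others.\<close>

lemma local_frame_section:
  assumes "(U, \<tau>) \<in> Tr" and "w \<in> F"
  shows "smooth_section_on At A Tr U (\<lambda>q. inv_into (A q) (\<tau> q) w)"
proof -
  have "smooth_map_on At (U \<inter> V) (\<lambda>q. \<tau>' q (inv_into (A q) (\<tau> q) w))" if "(V, \<tau>') \<in> Tr" for V \<tau>'
    using vector_bundle assms that unfolding smooth_vector_bundle_def by fast
  then show ?thesis
    unfolding smooth_section_on_def by (auto simp: Int_commute trivialization_inv(1)[OF assms(1) _ assms(2)])
qed

text \<open>Take the section that is constant in a trivialization and cut it off outside a
  neighbourhood of \<open>p\<close>.\<close>

lemma section_through:
  assumes "v \<in> A p"
  obtains s where "s \<in> \<Gamma>" and "s p = v"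
proof -
  obtain U \<tau> where U: "(U, \<tau>) \<in> Tr" "p \<in> U"
    by (rule trivialization_at)
  obtain \<eta> V where \<eta>: "cutoff U \<eta>" "p \<in> V" "\<And>q. q \<in> V \<Longrightarrow> \<eta> q = 1"
    using exists_cutoff[OF trivialization_open[OF U(1)] U(2)] by metis
  let ?s = "\<lambda>q. inv_into (A q) (\<tau> q) (\<tau> p v)"
  have "\<eta> \<odot> ?s \<in> \<Gamma>"
    using section_on_cutoff[OF local_frame_section[OF U(1)] trivialization_open[OF U(1)] \<eta>(1)]
      trivialization_in[OF U assms] by blast
  moreover have "(\<eta> \<odot> ?s) p = v"
    using \<eta> trivialization_inv(3)[OF U assms] by simp
  ultimately show ?thesis
    using that by blast
qed

text \<open>Over a trivializing open set, \<open>x = \<Sum>\<^sub>b c\<^sub>b e\<^sub>b\<close> in a local frame, hence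
  \<open>x = (1 - \<eta>\<^sup>2) x + \<Sum>\<^sub>b (\<eta> c\<^sub>b) (\<eta> e\<^sub>b)\<close> globally for a cutoff \<open>\<eta>\<close> with \<open>\<eta> p = 1\<close>;
  all coefficients vanish at \<open>p\<close>.\<close>

lemma tensorial_vanish:
  fixes T :: "('m \<Rightarrow> 'v) \<Rightarrow> 'm \<Rightarrow> 'z::real_vector"
  assumes add: "\<And>x y. x \<in> \<Gamma> \<Longrightarrow> y \<in> \<Gamma> \<Longrightarrow> T (x + y) = T x + T y"
    and fscale: "\<And>f x. f \<in> \<C> \<Longrightarrow> x \<in> \<Gamma> \<Longrightarrow> T (f \<odot> x) = f \<odot> T x"
    and x: "x \<in> \<Gamma>" "x p = 0"
  shows "T x p = 0"
proof -
  obtain U \<tau> where U: "(U, \<tau>) \<in> Tr" "p \<in> U"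
    by (rule trivialization_at)
  note U_open = trivialization_open[OF U(1)]
  obtain \<eta> V where \<eta>: "cutoff U \<eta>" "p \<in> V" "\<And>q. q \<in> V \<Longrightarrow> \<eta> q = 1"
    using exists_cutoff[OF U_open U(2)] by metis
  \<comment> \<open>Orthonormality makes the coordinates inner products with the basis vectors, so
    that their smoothness is immediate.\<close>
  obtain B where B: "B \<subseteq> F" "pairwise orthogonal B" "\<And>b. b \<in> B \<Longrightarrow> norm b = 1" "independent B" "span B = F"
    using orthonormal_basis_subspace[OF model_fibre_subspace] by metis
  have "finite B"
    using B(4) by (rule independent_imp_finite)
  define c where "c b = (\<lambda>q. \<eta> q * (\<tau> q (x q) \<bullet> b))" for b
  define e where "e b = \<eta> \<odot> (\<lambda>q. inv_into (A q) (\<tau> q) b)" for b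
  define g where "g = (\<lambda>q. 1 + (- 1) * (\<eta> q * \<eta> q))"
  have c: "c b \<in> \<C>" for b
    unfolding c_def smooth_functions_iff real_scaleR_def[symmetric]
    by (intro smooth_map_on_cutoff[OF \<eta>(1) U_open] smooth_map_on_inner smooth_map_on_const)
      (simp add: sectionD(2)[OF x(1) U(1)])
  have e: "e b \<in> \<Gamma>" if "b \<in> B" for b
    unfolding e_def using B(1) that
    by (intro section_on_cutoff[OF local_frame_section[OF U(1)] U_open \<eta>(1)]) auto
  have g: "g \<in> \<C>"
    using cutoff_smooth[OF \<eta>(1)] unfolding g_def smooth_functions_iff
    by (intro smooth_map_on_add smooth_map_on_mult smooth_map_on_const)
  have sum_in: "(\<Sum>b\<in>I. c b \<odot> e b) \<in> \<Gamma>" if "I \<subseteq> B" for I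
    using that by (intro subspace_sum[OF subspace_sections] section_fscale c e) auto
  have frame: "x q = (\<Sum>b\<in>B. (\<tau> q (x q) \<bullet> b) *\<^sub>R inv_into (A q) (\<tau> q) b)" (is "_ = ?y") if q: "q \<in> U" for q
  proof -
    note Uq = U(1) q
    have xq: "x q \<in> A q"
      by (rule sectionD(1)[OF x(1)])
    have inv: "inv_into (A q) (\<tau> q) b \<in> A q" "\<tau> q (inv_into (A q) (\<tau> q) b) = b" if "b \<in> B" for b
      using that B(1) trivialization_inv(1,2)[OF Uq] by auto
    \<comment> \<open>As \<open>\<tau> q\<close> is injective on the fibre, the expansion may be
      checked in \<open>F\<close>.\<close>
    have "\<tau> q ?y = (\<Sum>b\<in>B. (\<tau> q (x q) \<bullet> b) *\<^sub>R b)"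
      by (subst trivialization_sum[OF Uq])
        (auto simp: inv subspace_scale[OF fibre_subspace] trivialization_scaleR[OF Uq] intro!: sum.cong)
    also have "\<dots> = \<tau> q (x q)"
      by (rule orthonormal_basis_expand) (use B \<open>finite B\<close> trivialization_in[OF Uq xq] in auto)
    finally have "\<tau> q ?y = \<tau> q (x q)" .
    moreover have "?y \<in> A q"
      by (intro subspace_sum[OF fibre_subspace] subspace_scale[OF fibre_subspace] inv)
    ultimately show ?thesis
      using trivialization_bij[OF Uq] xq unfolding bij_betw_def inj_on_def by metis
  qed
  have decomposition: "x = g \<odot> x + (\<Sum>b\<in>B. c b \<odot> e b)"
  proof
    fix q
    show "x q = (g \<odot> x + (\<Sum>b\<in>B. c b \<odot> e b)) q"
    proof (cases "q \<in> U")
      case True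
      have "(\<Sum>b\<in>B. c b \<odot> e b) q = (\<eta> q * \<eta> q) *\<^sub>R x q"
        by (subst frame[OF True])
          (simp add: sum_fun_apply c_def e_def scaleR_sum_right mult_ac)
      then show ?thesis
        by (simp add: g_def algebra_simps)
    next
      case False
      then have "\<eta> q = 0"
        by (rule cutoff_eq_0[OF \<eta>(1)])
      then show ?thesis
        by (simp add: sum_fun_apply c_def g_def)
    qed
  qed
  have T0: "T 0 = 0"
    using add[of 0 0] section_0 by simp
  have T_sum: "T (\<Sum>b\<in>I. c b \<odot> e b) = (\<Sum>b\<in>I. c b \<odot> T (e b))" if "I \<subseteq> B" for I
    using finite_subset[OF that \<open>finite B\<close>] that
  proof (induction I)
    case (insert b I)
    then have "T (c b \<odot> e b + (\<Sum>b\<in>I. c b \<odot> e b)) = c b \<odot> T (e b) + (\<Sum>b\<in>I. c b \<odot> T (e b))"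
      using sum_in[of I] e[of b] c add[of "c b \<odot> e b" "\<Sum>b\<in>I. c b \<odot> e b"]
        fscale[of "c b" "e b"] section_fscale[of "c b" "e b"] by (auto simp del: fscale_apply)
    then show ?case
      unfolding sum.insert[OF insert.hyps] .
  qed (simp add: T0)
  have "T x = g \<odot> T x + (\<Sum>b\<in>B. c b \<odot> T (e b))"
    using decomposition T_sum[of B] sum_in[of B] add fscale[OF g x(1)] section_fscale[OF g x(1)] by (metis order_refl)
  then have "T x p = g p *\<^sub>R T x p + (\<Sum>b\<in>B. c b p *\<^sub>R T (e b) p)"
    by (metis (no_types, lifting) fscale_apply plus_fun_apply sum.cong sum_fun_apply)
  moreover have "g p = 0" and "c b p = 0" for b
    using \<eta>(2,3) x(2) trivialization_0[OF U] by (auto simp: g_def c_def)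
  ultimately show ?thesis
    by simp
qed

end

section \<open>Multilinear maps on tuples\<close>

lemma tuples_update: "xs \<in> tuples k S \<Longrightarrow> x \<in> S \<Longrightarrow> xs[i := x] \<in> tuples k S"
  using set_update_subset_insert[of xs i x] by (auto simp: tuples_def)

lemma tuples_nth: "xs \<in> tuples k S \<Longrightarrow> i < k \<Longrightarrow> xs ! i \<in> S"
  by (auto simp: tuples_def)

lemma tuples_length: "xs \<in> tuples k S \<Longrightarrow> length xs = k"
  by (simp add: tuples_def)

lemma tuples_snoc: "xs \<in> tuples k S \<Longrightarrow> x \<in> S \<Longrightarrow> xs @ [x] \<in> tuples (Suc k) S"
  by (auto simp: tuples_def)

lemma tuples_snocE:
  assumes "b \<in> tuples (Suc k) S"
  obtains xs x where "b = xs @ [x]" and "xs \<in> tuples k S" and "x \<in> S"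
  using assms by (cases b rule: rev_cases) (auto simp: tuples_def)

lemma tuples_map: "xs \<in> tuples k S \<Longrightarrow> (\<And>x. x \<in> S \<Longrightarrow> f x \<in> T) \<Longrightarrow> map f xs \<in> tuples k T"
  by (auto simp: tuples_def)

lemma multilinear_map_in: "multilinear_map k S T D \<Longrightarrow> xs \<in> tuples k S \<Longrightarrow> D xs \<in> T"
  by (auto simp: multilinear_map_def)

lemma multilinear_map_add:
  "multilinear_map k S T D \<Longrightarrow> xs \<in> tuples k S \<Longrightarrow> i < k \<Longrightarrow> x \<in> S \<Longrightarrow> y \<in> S \<Longrightarrow>
    D (xs[i := x + y]) = D (xs[i := x]) + D (xs[i := y])"
  unfolding multilinear_map_def by blast

lemma multilinear_map_scaleR:
  "multilinear_map k S T D \<Longrightarrow> xs \<in> tuples k S \<Longrightarrow> i < k \<Longrightarrow> x \<in> S \<Longrightarrow>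
    D (xs[i := c *\<^sub>R x]) = c *\<^sub>R D (xs[i := x])"
  unfolding multilinear_map_def by blast

lemma multilinear_map_zero:
  assumes "multilinear_map k S T D" and "xs \<in> tuples k S" and "i < k" and "xs ! i = 0"
  shows "D xs = 0"
proof -
  have "0 \<in> S"
    using tuples_nth[OF assms(2,3)] assms(4) by simp
  have "xs = xs[i := 0 *\<^sub>R 0]"
    using assms(4) by (metis list_update_id scale_zero_right)
  then have "D xs = 0 *\<^sub>R D (xs[i := 0])"
    using multilinear_map_scaleR[OF assms(1-3) \<open>0 \<in> S\<close>, of 0] by metis
  then show ?thesis
    by simp
qed

text \<open>Exchanging two equal entries leaves the list unchanged, so \<open>D xs = - D xs\<close>,
  and 2 is invertible over the reals.\<close>

lemma skew_symmetric_imp_alternating: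
  fixes D :: "'x list \<Rightarrow> 'y::real_vector"
  assumes "skew_symmetric k S D"
  shows "alternating k S D"
  unfolding alternating_def
proof (intro ballI allI impI)
  fix xs i j
  assume "xs \<in> tuples k S" "i < k" "j < k" and ij: "i \<noteq> j \<and> xs ! i = xs ! j"
  then have "D (xs[i := xs ! j, j := xs ! i]) = - D xs"
    using assms unfolding skew_symmetric_def by blast
  then have "D xs = - D xs"
    using ij by (metis list_update_id)
  then have "2 *\<^sub>R D xs = 0"
    by (metis add.right_inverse scaleR_2)
  then show "D xs = 0"
    by simp
qed

text \<open>Polarization: expand \<open>D\<close> with \<open>x + y\<close> in both places. The
  diagonal terms vanish, and the two remaining ones must be opposite.\<close>

lemma alternating_imp_skew_symmetric:
  assumes D: "multilinear_map k S T D" and alt: "alternating k S D" and "subspace S"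
  shows "skew_symmetric k S D"
  unfolding skew_symmetric_def
proof (intro ballI allI impI)
  fix xs i j
  assume xs: "xs \<in> tuples k S" and ij: "i < k" "j < k" "i \<noteq> j"
  let ?x = "xs ! i" and ?y = "xs ! j"
  let ?P = "\<lambda>u v. xs[i := u, j := v]"
  have S: "?x \<in> S" "?y \<in> S" "?x + ?y \<in> S"
    using xs ij \<open>subspace S\<close> by (auto simp: tuples_nth subspace_add)
  have in_tuples: "xs[i := u] \<in> tuples k S" "?P u v \<in> tuples k S" if "u \<in> S" "v \<in> S" for u v
    using that xs by (auto simp: tuples_update)
  have same: "D (?P u u) = 0" if "u \<in> S" for u
    using alt in_tuples(2)[OF that that] ij tuples_length[OF xs]
    unfolding alternating_def by (auto dest!: bspec spec[of _ i] spec[of _ j])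
  have right: "D (?P u (?x + ?y)) = D (?P u ?x) + D (?P u ?y)" if "u \<in> S" for u
    using multilinear_map_add[OF D in_tuples(1)[OF that that] ij(2) S(1,2)] .
  have left: "D (?P (?x + ?y) v) = D (?P ?x v) + D (?P ?y v)" if "v \<in> S" for v
    using multilinear_map_add[OF D tuples_update[OF xs that] ij(1) S(1,2), of j]
    by (simp only: list_update_swap[OF ij(3)])
  have "0 = D (?P ?x ?x) + D (?P ?x ?y) + (D (?P ?y ?x) + D (?P ?y ?y))"
    using same[OF S(3)] right[OF S(3)] left[OF S(1)] left[OF S(2)] by (simp add: ac_simps)
  then have "D (?P ?x ?y) + D (?P ?y ?x) = 0"
    using same[OF S(1)] same[OF S(2)] by simp
  then show "D (xs[i := xs ! j, j := xs ! i]) = - D xs"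
    by (simp add: add_eq_0_iff)
qed


section \<open>The fundamental identity\<close>

text \<open>The last argument \<open>z\<close> is split off to match the shape of
  \<open>der_comp\<close> and of the Leibniz rule.\<close>

definition fundamental_identity :: "nat \<Rightarrow> 'x::real_vector set \<Rightarrow> ('x list \<Rightarrow> 'x) \<Rightarrow> bool" where
  "fundamental_identity k S D \<longleftrightarrow>
     (\<forall>X\<in>tuples k S. \<forall>Y\<in>tuples k S. \<forall>z\<in>S.
        D (X @ [D (Y @ [z])]) = (\<Sum>i<k. D (Y[i := D (X @ [Y ! i])] @ [z])) + D (Y @ [D (X @ [z])]))"

lemma filippov_algebra_iff:
  assumes "n \<ge> 1"
  shows "filippov_algebra n L D \<longleftrightarrow>
    subspace L \<and> multilinear_map n L L D \<and> skew_symmetric n L D \<and> fundamental_identity (n - 1) L D"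
proof -
  obtain k where n: "n = Suc k"
    using assms by (cases n) auto
  \<comment> \<open>The last index of the sum hits \<open>z\<close> and gives the separate term; all
    earlier indices modify \<open>Y\<close>.\<close>
  have eq: "(\<Sum>i<n. D ((Y @ [z])[i := D (X @ [(Y @ [z]) ! i])])) =
      (\<Sum>i<k. D (Y[i := D (X @ [Y ! i])] @ [z])) + D (Y @ [D (X @ [z])])"
    if "Y \<in> tuples k L" for X Y z
    using tuples_length[OF that] by (simp add: n list_update_append nth_append)
  have "(\<forall>a\<in>tuples k L. \<forall>b\<in>tuples n L. D (a @ [D b]) = (\<Sum>i<n. D (b[i := D (a @ [b ! i])]))) \<longleftrightarrow>
      fundamental_identity k L D" (is "?lhs \<longleftrightarrow> _")
  proof
    assume L: ?lhs
    show "fundamental_identity k L D"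
      unfolding fundamental_identity_def
    proof (intro ballI)
      fix X Y z assume X: "X \<in> tuples k L" and Y: "Y \<in> tuples k L" and z: "z \<in> L"
      have "Y @ [z] \<in> tuples n L"
        using tuples_snoc[OF Y z] n by simp
      then show "D (X @ [D (Y @ [z])]) =
          (\<Sum>i<k. D (Y[i := D (X @ [Y ! i])] @ [z])) + D (Y @ [D (X @ [z])])"
        using bspec[OF bspec[OF L X], of "Y @ [z]"] eq[OF Y] by simp
    qed
  next
    assume R: "fundamental_identity k L D"
    show ?lhs
    proof (intro ballI)
      fix X b assume X: "X \<in> tuples k L" and "b \<in> tuples n L"
      then obtain Y z where b: "b = Y @ [z]" and Y: "Y \<in> tuples k L" and z: "z \<in> L"
        unfolding n by (elim tuples_snocE)
      show "D (X @ [D b]) = (\<Sum>i<n. D (b[i := D (X @ [b ! i])]))"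
        unfolding b eq[OF Y] using R X Y z unfolding fundamental_identity_def by blast
    qed
  qed
  then show ?thesis
    by (auto simp: filippov_algebra_def n)
qed

text \<open>For equal arguments the bracket is \<open>-2\<close> times \<open>der_comp\<close>, and
  \<open>der_comp\<close> is the right side of the fundamental identity minus the left.\<close>

lemma der_bracket_self_eq_0_iff:
  "(\<forall>X\<in>tuples (n - 1) S. \<forall>Y\<in>tuples (n - 1) S. \<forall>z\<in>S. der_bracket n D D X Y z = 0) \<longleftrightarrow>
    fundamental_identity (n - 1) S D"
proof -
  have "der_bracket n D D X Y z = 0 \<longleftrightarrow>
      D (X @ [D (Y @ [z])]) = (\<Sum>i<n - 1. D (Y[i := D (X @ [Y ! i])] @ [z])) + D (Y @ [D (X @ [z])])"
    for X Y z
  proof -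
    have "der_bracket n D D X Y z = - 2 *\<^sub>R der_comp n D D X Y z"
      by (simp add: der_bracket_def scaleR_2)
    then show ?thesis
      by (simp add: der_comp_def) (auto simp: algebra_simps)
  qed
  then show ?thesis
    by (simp add: fundamental_identity_def)
qed

lemma multilinear_map_snoc_add:
  assumes "multilinear_map n S T D" and "n \<ge> 1" and "X \<in> tuples (n - 1) S" and "x \<in> S" and "y \<in> S"
  shows "D (X @ [x + y]) = D (X @ [x]) + D (X @ [y])"
proof -
  have "X @ [x] \<in> tuples n S"
    using tuples_snoc[OF assms(3,4)] assms(2) by simp
  moreover have "(X @ [x])[n - 1 := u] = X @ [u]" for u
    using list_update_length[of X x "[]" u] tuples_length[OF assms(3)] by simp
  ultimately show ?thesis
    using multilinear_map_add[OF assms(1), of "X @ [x]" "n - 1" x y] assms(2,4,5) by simp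
qed


section \<open>Symbols and anchors\<close>

lemma is_symbolD:
  assumes "is_symbol At \<Gamma> n D \<sigma>"
  shows "multilinear_map (n - 1) \<Gamma> (vector_fields At) \<sigma>" and "alternating (n - 1) \<Gamma> \<sigma>"
    and "X \<in> tuples (n - 1) \<Gamma> \<Longrightarrow> i < n - 1 \<Longrightarrow> x \<in> \<Gamma> \<Longrightarrow> f \<in> smooth_functions At \<Longrightarrow>
        \<sigma> (X[i := f \<odot> x]) = f \<odot> \<sigma> (X[i := x])"
    and "X \<in> tuples (n - 1) \<Gamma> \<Longrightarrow> f \<in> smooth_functions At \<Longrightarrow> z \<in> \<Gamma> \<Longrightarrow>
        D (X @ [f \<odot> z]) = f \<odot> D (X @ [z]) + (\<lambda>p. \<sigma> X p f) \<odot> z"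
  using assms unfolding is_symbol_def by blast+

lemma is_symbol_vector_field:
  assumes "is_symbol At \<Gamma> n D \<sigma>" and "X \<in> tuples (n - 1) \<Gamma>"
  shows "\<sigma> X p \<in> tangent_space At p"
    and "f \<in> smooth_functions At \<Longrightarrow> (\<lambda>q. \<sigma> X q f) \<in> smooth_functions At"
  using multilinear_map_in[OF is_symbolD(1)[OF assms(1)] assms(2)] by (auto simp: vector_fields_def)

lemma tangent_vector_nonsmooth: "v \<in> tangent_space At p \<Longrightarrow> f \<notin> smooth_functions At \<Longrightarrow> v f = 0"
  by (simp add: tangent_space_def)

lemma tangent_vector_0:
  assumes "v \<in> tangent_space At p"
  shows "v (\<lambda>q. 0) = 0"
proof -
  have "v (0 *\<^sub>R (\<lambda>q. 0)) = 0 * v (\<lambda>q. 0)"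
    using assms const_smooth[of 0 At] unfolding tangent_space_def by blast
  then show ?thesis
    by (simp add: zero_fun_def)
qed

context smooth_bundle
begin

text \<open>The entries of \<open>X\<close> are exchanged for those of \<open>Y\<close> one at a
  time, through the lists \<open>take j Y @ drop j X\<close>. Each exchange alters the value by the
  symbol with a difference section in one slot; that section vanishes at \<open>p\<close>, so
  \<open>tensorial_vanish\<close> applies.\<close>

lemma symbol_tensorial:
  assumes \<sigma>: "is_symbol At \<Gamma> n D \<sigma>" and X: "X \<in> tuples (n - 1) \<Gamma>" and Y: "Y \<in> tuples (n - 1) \<Gamma>"
    and eq: "map (\<lambda>x. x p) X = map (\<lambda>x. x p) Y"
  shows "\<sigma> X p = \<sigma> Y p"
proof -
  note ml = is_symbolD(1)[OF \<sigma>]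
  have step: "\<sigma> (Z[j := x]) p = \<sigma> (Z[j := y]) p"
    if Z: "Z \<in> tuples (n - 1) \<Gamma>" and j: "j < n - 1" and xy: "x \<in> \<Gamma>" "y \<in> \<Gamma>" "x p = y p" for Z j x y
  proof -
    have d: "x + (- 1) *\<^sub>R y \<in> \<Gamma>"
      using xy by (intro section_add section_scaleR)
    have "\<sigma> (Z[j := x + (- 1) *\<^sub>R y]) p = 0"
      by (rule tensorial_vanish[where T="\<lambda>x. \<sigma> (Z[j := x])"])
        (use multilinear_map_add[OF ml Z j] is_symbolD(3)[OF \<sigma> Z j] d xy in auto)
    then show ?thesis
      using multilinear_map_add[OF ml Z j d xy(2)] by simp
  qed
  have "\<sigma> (take j Y @ drop j X) p = \<sigma> X p" if "j \<le> n - 1" for j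
    using that
  proof (induction j)
    case (Suc j)
    then have j: "j < length X" "j < length Y" "j < n - 1"
      using tuples_length[OF X] tuples_length[OF Y] by auto
    let ?Z = "take j Y @ drop j X"
    have "set ?Z \<subseteq> \<Gamma>" and len: "length ?Z = n - 1"
      using X Y j set_take_subset[of j Y] set_drop_subset[of j X] by (auto simp: tuples_def)
    then have Z: "?Z \<in> tuples (n - 1) \<Gamma>"
      by (simp add: tuples_def)
    have "?Z[j := Y ! j] = take (Suc j) Y @ drop (Suc j) X"
      using j by (simp add: take_Suc_conv_app_nth list_update_append Cons_nth_drop_Suc[symmetric])
    moreover have "?Z[j := X ! j] = ?Z"
      using j by (simp add: list_update_append Cons_nth_drop_Suc[symmetric])
    moreover have "(X ! j) p = (Y ! j) p"
      using arg_cong[OF eq, of "\<lambda>l. l ! j"] j by simp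
    ultimately have "\<sigma> (take (Suc j) Y @ drop (Suc j) X) p = \<sigma> ?Z p"
      using step[OF Z j(3) tuples_nth[OF X j(3)] tuples_nth[OF Y j(3)]] by simp
    then show ?case
      using Suc by simp
  qed simp
  from this[of "n - 1"] show ?thesis
    using tuples_length[OF X] tuples_length[OF Y] by simp
qed

lemma tuple_through:
  assumes "vs \<in> tuples k (A p)"
  obtains X where "X \<in> tuples k \<Gamma>" and "map (\<lambda>x. x p) X = vs"
proof -
  have "\<forall>v\<in>A p. \<exists>s. s \<in> \<Gamma> \<and> s p = v"
    by (meson section_through)
  then obtain s where s: "\<forall>v\<in>A p. s v \<in> \<Gamma> \<and> s v p = v"
    by (rule bchoice[THEN exE])
  have "map s vs \<in> tuples k \<Gamma>"
    using assms s by (auto intro: tuples_map)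
  moreover have "map (\<lambda>x. x p) (map s vs) = vs"
    using assms s by (auto simp: tuples_def subset_iff intro!: map_idI)
  ultimately show ?thesis
    using that by blast
qed

lemma tuple_at: "X \<in> tuples k \<Gamma> \<Longrightarrow> map (\<lambda>x. x p) X \<in> tuples k (A p)"
  by (rule tuples_map) (auto dest: sectionD(1))

text \<open>All sections vanish at \<open>p\<close>, so by tensoriality the zero section may be put
  into the first slot, which exists because \<open>n \<ge> 2\<close>.\<close>

lemma symbol_zero_fibre:
  assumes \<sigma>: "is_symbol At \<Gamma> n D \<sigma>" and "n \<ge> 2" and "A p = {0}" and X: "X \<in> tuples (n - 1) \<Gamma>"
  shows "\<sigma> X p = 0"
proof -
  have "(Z ! i) p = 0" if "Z \<in> tuples (n - 1) \<Gamma>" "i < n - 1" for Z i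
    using sectionD(1)[OF tuples_nth[OF that], of p] assms(3) by simp
  then have "map (\<lambda>x. x p) X = map (\<lambda>x. x p) (X[0 := 0])"
    using X tuples_update[OF X section_0, of 0] tuples_length[OF X] by (intro nth_equalityI) auto
  then have "\<sigma> X p = \<sigma> (X[0 := 0]) p"
    using X by (intro symbol_tensorial[OF \<sigma>] tuples_update section_0)
  also have "\<sigma> (X[0 := 0]) = 0"
    using assms(2) tuples_length[OF X]
    by (intro multilinear_map_zero[OF is_symbolD(1)[OF \<sigma>] tuples_update[OF X section_0], of 0]) auto
  finally show ?thesis
    unfolding func_zero .
qed

text \<open>Where the fibre is nonzero, apply the Leibniz rule to a section \<open>z\<close> with
  \<open>z p\<close> nonzero and cancel that vector. On non-smooth functions both derivations are 0
  by convention.\<close>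

lemma symbol_unique:
  assumes \<sigma>: "is_symbol At \<Gamma> n D \<sigma>" and \<sigma>': "is_symbol At \<Gamma> n D \<sigma>'" and "n \<ge> 2"
    and X: "X \<in> tuples (n - 1) \<Gamma>"
  shows "\<sigma> X = \<sigma>' X"
proof
  fix p
  show "\<sigma> X p = \<sigma>' X p"
  proof (cases "A p = {0}")
    case True
    then show ?thesis
      using symbol_zero_fibre[OF \<sigma> assms(3) _ X] symbol_zero_fibre[OF \<sigma>' assms(3) _ X] by simp
  next
    case False
    then obtain v where v: "v \<in> A p" "v \<noteq> 0"
      using subspace_0[OF fibre_subspace] by blast
    obtain z where z: "z \<in> \<Gamma>" "z p = v"
      using section_through[OF v(1)] .
    show ?thesis
    proof
      fix f
      show "\<sigma> X p f = \<sigma>' X p f"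
      proof (cases "f \<in> \<C>")
        case True
        have "(\<lambda>p. \<sigma> X p f) \<odot> z = (\<lambda>p. \<sigma>' X p f) \<odot> z"
          using is_symbolD(4)[OF \<sigma> X True z(1)] is_symbolD(4)[OF \<sigma>' X True z(1)] by simp
        from fun_cong[OF this, of p] show ?thesis
          using v(2) z(2) by simp
      next
        case False
        then show ?thesis
          using tangent_vector_nonsmooth[OF is_symbol_vector_field(1)[OF \<sigma> X]]
            tangent_vector_nonsmooth[OF is_symbol_vector_field(1)[OF \<sigma>' X]]
          by simp
      qed
    qed
  qed
qed

text \<open>Apply the fundamental identity to \<open>f z\<close> and expand by the Leibniz rule: the terms without
  derivatives of \<open>f\<close> and those with one derivative cancel, leaving the difference of the two sides
  applied to \<open>f\<close>, times \<open>z\<close>.\<close>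

lemma symbol_bracket:
  assumes \<sigma>: "is_symbol At \<Gamma> n D \<sigma>" and n: "n \<ge> 2" and D: "multilinear_map n \<Gamma> \<Gamma> D"
    and FI: "fundamental_identity (n - 1) \<Gamma> D"
    and X: "X \<in> tuples (n - 1) \<Gamma>" and Y: "Y \<in> tuples (n - 1) \<Gamma>"
  shows "lie_bracket (\<sigma> X) (\<sigma> Y) = (\<Sum>i<n - 1. \<sigma> (Y[i := D (X @ [Y ! i])]))"
proof (intro ext)
  fix p f
  have D_in: "D (Z @ [z]) \<in> \<Gamma>" if "Z \<in> tuples (n - 1) \<Gamma>" "z \<in> \<Gamma>" for Z z
    using multilinear_map_in[OF D] tuples_snoc[OF that] n by simp
  define Z where "Z i = Y[i := D (X @ [Y ! i])]" for i
  have Z: "Z i \<in> tuples (n - 1) \<Gamma>" if "i < n - 1" for i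
    unfolding Z_def using that by (intro tuples_update Y D_in X tuples_nth[OF Y])
  note X_field = is_symbol_vector_field[OF \<sigma> X] and Y_field = is_symbol_vector_field[OF \<sigma> Y]
  have "\<sigma> X p (\<lambda>q. \<sigma> Y q f) - \<sigma> Y p (\<lambda>q. \<sigma> X q f) = (\<Sum>i<n - 1. \<sigma> (Z i) p f)"
  proof -
    consider "f \<notin> \<C>" | "A p = {0}" | v where "f \<in> \<C>" "v \<in> A p" "v \<noteq> 0"
      using subspace_0[OF fibre_subspace] by blast
    then show ?thesis
    proof cases
      case 1
      then have "\<sigma> X q f = 0" "\<sigma> Y q f = 0" "i < n - 1 \<Longrightarrow> \<sigma> (Z i) q f = 0" for q i
        using tangent_vector_nonsmooth[OF X_field(1)] tangent_vector_nonsmooth[OF Y_field(1)]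
          tangent_vector_nonsmooth[OF is_symbol_vector_field(1)[OF \<sigma> Z]] by auto
      \<comment> \<open>The inner functions of the Lie bracket are now identically 0, and tangent
        vectors annihilate the zero function.\<close>
      then show ?thesis
        using tangent_vector_0[OF X_field(1)] tangent_vector_0[OF Y_field(1)] by simp
    next
      case 2
      then show ?thesis
        using symbol_zero_fibre[OF \<sigma> n 2] X Y Z by simp
    next
      case 3
      obtain z where z: "z \<in> \<Gamma>" "z p = v"
        using section_through[OF 3(2)] .
      note f = \<open>f \<in> \<C>\<close>
      define g where "g = (\<lambda>q. \<sigma> X q f)"
      define h where "h = (\<lambda>q. \<sigma> Y q f)"
      have gh: "g \<in> \<C>" "h \<in> \<C>"
        using X_field(2)[OF f] Y_field(2)[OF f] by (auto simp: g_def h_def)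
      note leibniz = is_symbolD(4)[OF \<sigma>]
      \<comment> \<open>The two terms with one derivative of \<open>f\<close> are interchanged when
        \<open>V\<close> and \<open>W\<close> are, so they cancel in the fundamental identity; the
        terms with two derivatives leave the commutator.\<close>
      have twice: "D (V @ [D (W @ [f \<odot> z])]) =
          f \<odot> D (V @ [D (W @ [z])]) + (\<lambda>q. \<sigma> V q f) \<odot> D (W @ [z])
          + ((\<lambda>q. \<sigma> W q f) \<odot> D (V @ [z]) + (\<lambda>q. \<sigma> V q (\<lambda>r. \<sigma> W r f)) \<odot> z)"
        if V: "V \<in> tuples (n - 1) \<Gamma>" and W: "W \<in> tuples (n - 1) \<Gamma>" for V W
      proof -
        have Wf: "(\<lambda>q. \<sigma> W q f) \<in> \<C>"
          by (rule is_symbol_vector_field(2)[OF \<sigma> W f])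
        have "D (V @ [f \<odot> D (W @ [z]) + (\<lambda>q. \<sigma> W q f) \<odot> z]) =
            D (V @ [f \<odot> D (W @ [z])]) + D (V @ [(\<lambda>q. \<sigma> W q f) \<odot> z])"
          using n by (intro multilinear_map_snoc_add[OF D _ V] section_fscale f Wf D_in W z) auto
        then show ?thesis
          by (simp only: leibniz[OF W f z(1)] leibniz[OF V f D_in[OF W z(1)]] leibniz[OF V Wf z(1)])
      qed
      have "D (X @ [D (Y @ [f \<odot> z])]) = (\<Sum>i<n - 1. D (Z i @ [f \<odot> z])) + D (Y @ [D (X @ [f \<odot> z])])"
        using FI X Y section_fscale[OF f z(1)] unfolding fundamental_identity_def Z_def by blast
      also have "(\<Sum>i<n - 1. D (Z i @ [f \<odot> z])) = (\<Sum>i<n - 1. f \<odot> D (Z i @ [z]) + (\<lambda>q. \<sigma> (Z i) q f) \<odot> z)"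
        using leibniz[OF Z f z(1)] by simp
      finally have "(f \<odot> D (X @ [D (Y @ [z])]) + g \<odot> D (Y @ [z]) + (h \<odot> D (X @ [z]) + (\<lambda>q. \<sigma> X q h) \<odot> z)) p =
          ((\<Sum>i<n - 1. f \<odot> D (Z i @ [z]) + (\<lambda>q. \<sigma> (Z i) q f) \<odot> z) +
          (f \<odot> D (Y @ [D (X @ [z])]) + h \<odot> D (X @ [z]) + (g \<odot> D (Y @ [z]) + (\<lambda>q. \<sigma> Y q g) \<odot> z))) p"
        unfolding twice[OF X Y] twice[OF Y X] g_def h_def by (rule fun_cong)
      then have "f p *\<^sub>R D (X @ [D (Y @ [z])]) p + \<sigma> X p h *\<^sub>R v =
          f p *\<^sub>R ((\<Sum>i<n - 1. D (Z i @ [z]) p) + D (Y @ [D (X @ [z])]) p) +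
          (\<Sum>i<n - 1. \<sigma> (Z i) p f) *\<^sub>R v + \<sigma> Y p g *\<^sub>R v"
        by (simp add: z(2) sum_fun_apply sum.distrib scaleR_add_right scaleR_sum_right scaleR_sum_left)
      moreover have "D (X @ [D (Y @ [z])]) = (\<Sum>i<n - 1. D (Z i @ [z])) + D (Y @ [D (X @ [z])])"
        using FI X Y z(1) unfolding fundamental_identity_def Z_def by blast
      then have "D (X @ [D (Y @ [z])]) p = (\<Sum>i<n - 1. D (Z i @ [z]) p) + D (Y @ [D (X @ [z])]) p"
        by (simp only: plus_fun_apply sum_fun_apply)
      ultimately have "\<sigma> X p h *\<^sub>R v = (\<Sum>i<n - 1. \<sigma> (Z i) p f) *\<^sub>R v + \<sigma> Y p g *\<^sub>R v"
        by (simp only: add.assoc add_left_cancel)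
      then have "(\<sigma> X p h - \<sigma> Y p g - (\<Sum>i<n - 1. \<sigma> (Z i) p f)) *\<^sub>R v = 0"
        by (simp add: scaleR_diff_left)
      then show ?thesis
        using 3(3) by (simp add: g_def h_def)
    qed
  qed
  then show "lie_bracket (\<sigma> X) (\<sigma> Y) p f = (\<Sum>i<n - 1. \<sigma> (Y[i := D (X @ [Y ! i])])) p f"
    by (simp add: lie_bracket_def sum_fun_apply Z_def)
qed

text \<open>Vectors are extended to global sections by an arbitrary choice, harmless by
  \<open>symbol_tensorial\<close>. The restricted abstraction supplies the extensionality demanded
  of bundle maps.\<close>

definition anchor :: "nat \<Rightarrow> (('m \<Rightarrow> 'v) list \<Rightarrow> 'm \<Rightarrow> ('m \<Rightarrow> real) \<Rightarrow> real) \<Rightarrow>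
    'm \<Rightarrow> 'v list \<Rightarrow> ('m \<Rightarrow> real) \<Rightarrow> real" where
  "anchor k \<sigma> p = (\<lambda>vs\<in>tuples k (A p). \<sigma> (SOME X. X \<in> tuples k \<Gamma> \<and> map (\<lambda>x. x p) X = vs) p)"

context
  fixes n D \<sigma>
  assumes \<sigma>: "is_symbol At \<Gamma> n D \<sigma>"
begin

lemma anchor_apply:
  assumes X: "X \<in> tuples (n - 1) \<Gamma>"
  shows "anchor (n - 1) \<sigma> p (map (\<lambda>x. x p) X) = \<sigma> X p"
proof -
  let ?Y = "SOME Y. Y \<in> tuples (n - 1) \<Gamma> \<and> map (\<lambda>x. x p) Y = map (\<lambda>x. x p) X"
  have "?Y \<in> tuples (n - 1) \<Gamma> \<and> map (\<lambda>x. x p) ?Y = map (\<lambda>x. x p) X"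
    by (rule someI[where x=X and P="\<lambda>Y. Y \<in> tuples (n - 1) \<Gamma> \<and> map (\<lambda>x. x p) Y = map (\<lambda>x. x p) X"])
      (use X in blast)
  then have "\<sigma> ?Y p = \<sigma> X p"
    using X by (intro symbol_tensorial[OF \<sigma>]) auto
  then show ?thesis
    using tuple_at[OF X] by (simp add: anchor_def)
qed

lemma on_sections_anchor: "X \<in> tuples (n - 1) \<Gamma> \<Longrightarrow> on_sections (anchor (n - 1) \<sigma>) X = \<sigma> X"
  by (simp add: on_sections_def anchor_apply del: One_nat_def)

text \<open>Changing one vector in a fibre lifts to changing one section, which is how
  multilinearity and alternation pass from the symbol to the anchor.\<close>

lemma anchor_apply_update:
  assumes "X \<in> tuples (n - 1) \<Gamma>" and "x \<in> \<Gamma>"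
  shows "anchor (n - 1) \<sigma> p ((map (\<lambda>x. x p) X)[i := x p]) = \<sigma> (X[i := x]) p"
  using anchor_apply[OF tuples_update[OF assms], of p i] by (simp add: map_update)

lemma exterior_bundle_map_anchor: "exterior_bundle_map At A Tr (n - 1) (anchor (n - 1) \<sigma>)"
proof -
  let ?k = "n - 1" and ?a = "anchor (n - 1) \<sigma>"
  note ml = is_symbolD(1)[OF \<sigma>]
  have "multilinear_map ?k (A p) (tangent_space At p) (?a p)" for p
    unfolding multilinear_map_def
  proof (intro conjI ballI allI impI funcsetI)
    fix vs assume "vs \<in> tuples ?k (A p)"
    then obtain X where X: "X \<in> tuples ?k \<Gamma>" "map (\<lambda>x. x p) X = vs"
      by (rule tuple_through)
    show "?a p vs \<in> tangent_space At p"
      using is_symbol_vector_field(1)[OF \<sigma> X(1)] anchor_apply[OF X(1), of p] X(2) by simp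
    fix i v assume i: "i < ?k" and "v \<in> A p"
    then obtain x where x: "x \<in> \<Gamma>" "x p = v"
      using section_through by blast
    show "?a p (vs[i := c *\<^sub>R v]) = c *\<^sub>R ?a p (vs[i := v])" for c
      using anchor_apply_update[OF X(1) section_scaleR[OF x(1)], of p i c]
        anchor_apply_update[OF X(1) x(1), of p i] multilinear_map_scaleR[OF ml X(1) i x(1), of c] x(2) X(2)
      by simp
    fix w assume "w \<in> A p"
    then obtain y where y: "y \<in> \<Gamma>" "y p = w"
      using section_through by blast
    show "?a p (vs[i := v + w]) = ?a p (vs[i := v]) + ?a p (vs[i := w])"
      using anchor_apply_update[OF X(1) section_add[OF x(1) y(1)], of p i]
        anchor_apply_update[OF X(1) x(1), of p i] anchor_apply_update[OF X(1) y(1), of p i]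
        multilinear_map_add[OF ml X(1) i x(1) y(1)] x(2) y(2) X(2)
      by simp
  qed
  moreover have "alternating ?k (A p) (?a p)" for p
    unfolding alternating_def
  proof (intro ballI allI impI)
    fix vs i j
    assume vs: "vs \<in> tuples ?k (A p)" and ij: "i < ?k" "j < ?k" "i \<noteq> j \<and> vs ! i = vs ! j"
    obtain X where X: "X \<in> tuples ?k \<Gamma>" "map (\<lambda>x. x p) X = vs"
      using tuple_through[OF vs] .
    have Xi: "X ! i \<in> \<Gamma>"
      by (rule tuples_nth[OF X(1) ij(1)])
    \<comment> \<open>Equal vectors may have been extended to different sections. Replacing the
      section in slot \<open>j\<close> by the one in slot \<open>i\<close> keeps the values at
      \<open>p\<close> and makes the sections equal.\<close>
    have "(X ! i) p = vs ! j"
      using nth_map[of i X "\<lambda>x. x p"] X(2) ij tuples_length[OF X(1)] by simp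
    then have "?a p vs = \<sigma> (X[j := X ! i]) p"
      using anchor_apply_update[OF X(1) Xi, of p j] X(2) by simp
    also have "\<sigma> (X[j := X ! i]) = 0"
      using is_symbolD(2)[OF \<sigma>] tuples_update[OF X(1) Xi, of j] ij tuples_length[OF X(1)]
      unfolding alternating_def by (auto dest!: bspec spec[of _ i] spec[of _ j])
    finally show "?a p vs = 0"
      unfolding func_zero .
  qed
  moreover have "smooth_map_on At W (\<lambda>p. ?a p (map (\<lambda>x. x p) X) f)"
    if W: "open W" and X: "X \<in> tuples ?k {s. smooth_section_on At A Tr W s}" and f: "f \<in> \<C>" for W X f
  proof (rule smooth_map_on_locally)
    fix p assume "p \<in> W"
    then obtain \<eta> V where \<eta>: "cutoff W \<eta>" "open V" "p \<in> V" "\<And>q. q \<in> V \<Longrightarrow> \<eta> q = 1"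
      using exists_cutoff[OF W] by metis
    \<comment> \<open>The symbol accepts only global sections; the cut-off ones agree with the local
      ones on \<open>V\<close>, where \<open>\<eta>\<close> is 1.\<close>
    have Y: "map (\<lambda>x. \<eta> \<odot> x) X \<in> tuples ?k \<Gamma>"
      using X by (rule tuples_map) (auto intro: section_on_cutoff W \<eta>(1))
    have "smooth_map_on At (V \<inter> W) (\<lambda>q. \<sigma> (map (\<lambda>x. \<eta> \<odot> x) X) q f)"
      using is_symbol_vector_field(2)[OF \<sigma> Y f] by (rule smooth_functions_imp_on)
    then have "smooth_map_on At (V \<inter> W) (\<lambda>p. ?a p (map (\<lambda>x. x p) X) f)"
    proof (rule smooth_map_on_cong)
      fix q assume "q \<in> V \<inter> W"
      then have "map (\<lambda>x. x q) (map (\<lambda>x. \<eta> \<odot> x) X) = map (\<lambda>x. x q) X"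
        using \<eta>(4) by simp
      then show "\<sigma> (map (\<lambda>x. \<eta> \<odot> x) X) q f = ?a q (map (\<lambda>x. x q) X) f"
        using fun_cong[OF anchor_apply[OF Y, of q], of f] by (simp only:)
    qed
    then show "\<exists>V. open V \<and> p \<in> V \<and> smooth_map_on At (V \<inter> W) (\<lambda>p. ?a p (map (\<lambda>x. x p) X) f)"
      using \<eta>(2,3) by blast
  qed
  ultimately show ?thesis
    unfolding exterior_bundle_map_def by (auto simp: anchor_def)
qed

end


section \<open>The correspondence\<close>

lemma exterior_bundle_mapD:
  assumes "exterior_bundle_map At A Tr k a"
  shows "a p \<in> extensional (tuples k (A p))" and "multilinear_map k (A p) (tangent_space At p) (a p)"
    and "alternating k (A p) (a p)"
    and "open W \<Longrightarrow> X \<in> tuples k {s. smooth_section_on At A Tr W s} \<Longrightarrow> f \<in> \<C> \<Longrightarrow>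
      smooth_map_on At W (\<lambda>p. a p (map (\<lambda>x. x p) X) f)"
  using assms unfolding exterior_bundle_map_def by blast+

lemma on_sections_vector_field:
  assumes a: "exterior_bundle_map At A Tr k a" and X: "X \<in> tuples k \<Gamma>"
  shows "on_sections a X \<in> vector_fields At"
proof -
  have "X \<in> tuples k {s. smooth_section_on At A Tr UNIV s}"
    using X by (simp add: smooth_sections_def)
  then show ?thesis
    using exterior_bundle_mapD(4)[OF a open_UNIV] multilinear_map_in[OF exterior_bundle_mapD(2)[OF a] tuple_at[OF X]]
    by (auto simp: vector_fields_def on_sections_def smooth_functions_iff)
qed

lemma structures_iff:
  "(br, a) \<in> filippov_algebroid_structures At A Tr n \<longleftrightarrow>
     br \<in> extensional (tuples n \<Gamma>) \<and> filippov_algebra n \<Gamma> br \<and> exterior_bundle_map At A Tr (n - 1) a \<and>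
     (\<forall>X\<in>tuples (n - 1) \<Gamma>. \<forall>Y\<in>tuples (n - 1) \<Gamma>.
        lie_bracket (on_sections a X) (on_sections a Y) =
          (\<Sum>i<n - 1. on_sections a (Y[i := br (X @ [Y ! i])]))) \<and>
     (\<forall>X\<in>tuples (n - 1) \<Gamma>. \<forall>y\<in>\<Gamma>. \<forall>f\<in>\<C>.
        br (X @ [f \<odot> y]) = f \<odot> br (X @ [y]) + (\<lambda>p. on_sections a X p f) \<odot> y)"
  by (simp add: filippov_algebroid_structures_def Let_def)

lemma maurer_cartan_iff:
  "D \<in> maurer_cartan_elements At A Tr n \<longleftrightarrow>
     D \<in> extensional (tuples n \<Gamma>) \<and> multilinear_map n \<Gamma> \<Gamma> D \<and> alternating n \<Gamma> D \<and>
     (\<exists>\<sigma>. is_symbol At \<Gamma> n D \<sigma>) \<and> fundamental_identity (n - 1) \<Gamma> D"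
  unfolding maurer_cartan_elements_def Der1_def Let_def mem_Collect_eq der_bracket_self_eq_0_iff by blast

text \<open>Fibrewise linearity yields linearity over smooth functions, because at \<open>p\<close>
  the section \<open>f \<odot> x\<close> is the real multiple \<open>f p\<close> of
  \<open>x p\<close>.\<close>

lemma structure_symbol:
  assumes "(br, a) \<in> filippov_algebroid_structures At A Tr n"
  shows "is_symbol At \<Gamma> n br (on_sections a)"
proof -
  have a: "exterior_bundle_map At A Tr (n - 1) a"
    using assms by (simp add: structures_iff)
  have ml: "multilinear_map (n - 1) (A p) (tangent_space At p) (a p)" for p
    by (rule exterior_bundle_mapD(2)[OF a])
  have eval: "map (\<lambda>x. x p) (X[i := x]) = (map (\<lambda>x. x p) X)[i := x p]" for X :: "('m \<Rightarrow> 'v) list" and p i x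
    by (rule map_update)
  have "multilinear_map (n - 1) \<Gamma> (vector_fields At) (on_sections a)"
    unfolding multilinear_map_def
    by (auto intro!: on_sections_vector_field[OF a] simp del: One_nat_def)
      (auto simp: on_sections_def fun_eq_iff eval sectionD(1)
        multilinear_map_add[OF ml tuple_at] multilinear_map_scaleR[OF ml tuple_at] simp del: One_nat_def)
  moreover have "alternating (n - 1) \<Gamma> (on_sections a)"
    unfolding alternating_def
  proof (intro ballI allI impI ext)
    fix X i j p f assume X: "X \<in> tuples (n - 1) \<Gamma>" "i < n - 1" "j < n - 1" "i \<noteq> j \<and> X ! i = X ! j"
    then have "map (\<lambda>x. x p) X ! i = map (\<lambda>x. x p) X ! j"
      using tuples_length[OF X(1)] by simp
    then have "a p (map (\<lambda>x. x p) X) = 0"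
      using exterior_bundle_mapD(3)[OF a, of p] tuple_at[OF X(1), of p] X(2-4)
      unfolding alternating_def by blast
    then show "on_sections a X p f = 0 p f"
      by (simp add: on_sections_def)
  qed
  moreover have "on_sections a (X[i := f \<odot> x]) = f \<odot> on_sections a (X[i := x])"
    if "X \<in> tuples (n - 1) \<Gamma>" "i < n - 1" "x \<in> \<Gamma>" for X i x f
    using that by (simp add: fun_eq_iff on_sections_def eval sectionD(1) multilinear_map_scaleR[OF ml tuple_at]
        del: One_nat_def)
  ultimately show ?thesis
    using assms by (simp add: is_symbol_def structures_iff)
qed

lemma structure_bracket:
  assumes "n \<ge> 2" and "(br, a) \<in> filippov_algebroid_structures At A Tr n"
  shows "br \<in> maurer_cartan_elements At A Tr n"
proof -
  have "1 \<le> n"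
    using assms(1) by simp
  then show ?thesis
    using assms(2) structure_symbol[OF assms(2)] skew_symmetric_imp_alternating
    by (auto simp: maurer_cartan_iff structures_iff filippov_algebra_iff)
qed

text \<open>Every tuple of vectors of a fibre consists of the values of global sections, so
  \<open>symbol_unique\<close> decides; on all other lists both maps are
  \<open>undefined\<close>.\<close>

lemma anchor_unique:
  assumes "n \<ge> 2" and a: "(br, a) \<in> filippov_algebroid_structures At A Tr n"
    and b: "(br, b) \<in> filippov_algebroid_structures At A Tr n"
  shows "a = b"
proof (rule ext, rule ext)
  fix p vs
  show "a p vs = b p vs"
  proof (cases "vs \<in> tuples (n - 1) (A p)")
    case True
    then obtain X where X: "X \<in> tuples (n - 1) \<Gamma>" "map (\<lambda>x. x p) X = vs"
      by (rule tuple_through)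
    have "on_sections a X p = on_sections b X p"
      using symbol_unique[OF structure_symbol[OF a] structure_symbol[OF b] assms(1) X(1)] by simp
    then show ?thesis
      using X(2) by (simp add: on_sections_def)
  next
    case False
    then show ?thesis
      using a b exterior_bundle_mapD(1) unfolding structures_iff extensional_def by fastforce
  qed
qed

text \<open>Any symbol of \<open>D\<close> will do: its anchor reproduces it on sections, so the two
  anchor conditions become \<open>symbol_bracket\<close> and the Leibniz rule of the symbol.\<close>

lemma maurer_cartan_structure:
  assumes n: "n \<ge> 2" and D: "D \<in> maurer_cartan_elements At A Tr n"
  obtains a where "(D, a) \<in> filippov_algebroid_structures At A Tr n"
proof -
  obtain \<sigma> where \<sigma>: "is_symbol At \<Gamma> n D \<sigma>"
    using D by (auto simp: maurer_cartan_iff)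
  have ml: "multilinear_map n \<Gamma> \<Gamma> D" and FI: "fundamental_identity (n - 1) \<Gamma> D"
    and alt: "alternating n \<Gamma> D" and ext: "D \<in> extensional (tuples n \<Gamma>)"
    using D by (auto simp: maurer_cartan_iff)
  let ?a = "anchor (n - 1) \<sigma>"
  have "filippov_algebra n \<Gamma> D"
    using n ml FI subspace_sections alternating_imp_skew_symmetric[OF ml alt subspace_sections]
    by (simp add: filippov_algebra_iff)
  moreover have "lie_bracket (on_sections ?a X) (on_sections ?a Y) =
      (\<Sum>i<n - 1. on_sections ?a (Y[i := D (X @ [Y ! i])]))"
    if X: "X \<in> tuples (n - 1) \<Gamma>" and Y: "Y \<in> tuples (n - 1) \<Gamma>" for X Y
  proof -
    have "Y[i := D (X @ [Y ! i])] \<in> tuples (n - 1) \<Gamma>" if "i < n - 1" for i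
      using tuples_update[OF Y multilinear_map_in[OF ml]] tuples_snoc[OF X tuples_nth[OF Y that]] n
      by simp
    then show ?thesis
      by (simp add: on_sections_anchor[OF \<sigma>] X Y symbol_bracket[OF \<sigma> n ml FI] del: One_nat_def)
  qed
  ultimately have "(D, ?a) \<in> filippov_algebroid_structures At A Tr n"
    using is_symbolD(4)[OF \<sigma>] ext
    by (simp add: structures_iff exterior_bundle_map_anchor[OF \<sigma>] on_sections_anchor[OF \<sigma>]
        del: One_nat_def)
  then show ?thesis
    using that by blast
qed

end

theorem proposition3p5:
  fixes E :: "'e::euclidean_space set"
    and At :: "('m::{t2_space, second_countable_topology}, 'e) atlas"
    and F :: "'f::euclidean_space set"
    and A :: "'m \<Rightarrow> 'v::real_vector set"
    and Tr :: "('m, 'v, 'f) trivializations"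
    and n :: nat
  assumes "n \<ge> 2"
    and "smooth_manifold E At"
    and "smooth_vector_bundle At F A Tr"
  shows "bij_betw fst (filippov_algebroid_structures At A Tr n) (maurer_cartan_elements At A Tr n) \<and>
    (\<forall>(br, a) \<in> filippov_algebroid_structures At A Tr n.
       is_symbol At (smooth_sections At A Tr) n br (on_sections a))"
proof -
  interpret smooth_bundle E At F A Tr
    by unfold_locales (fact assms(2,3))+
  have "inj_on fst (filippov_algebroid_structures At A Tr n)"
    using anchor_unique[OF assms(1)] by (auto intro!: inj_onI)
  moreover have "fst ` filippov_algebroid_structures At A Tr n = maurer_cartan_elements At A Tr n"
  proof
    show "maurer_cartan_elements At A Tr n \<subseteq> fst ` filippov_algebroid_structures At A Tr n"
    proof
      fix D assume "D \<in> maurer_cartan_elements At A Tr n"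
      then obtain a where "(D, a) \<in> filippov_algebroid_structures At A Tr n"
        by (rule maurer_cartan_structure[OF assms(1)])
      then show "D \<in> fst ` filippov_algebroid_structures At A Tr n"
        by (rule rev_image_eqI) simp
    qed
  qed (use structure_bracket[OF assms(1)] in auto)
  ultimately show ?thesis
    using structure_symbol by (auto simp: bij_betw_def)
qed

end
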